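(* 1. Let $(X,M),(Y,N)$ be partition spaces, and let $f:X\rightarrow Y$ be uniformly continuous. Then $S^{*}(\mathfrak{B}^{*}(f))\circ\mathcal{C}_{(X,M)}=\mathcal{C}_{(Y,N)}\circ f$. 2. Let $(A,F),(B,G)$ be stable Boolean partition algebras, and let $f:(A,F)\rightarrow(B,G)$ be a partition homomorphism. Then $\mathfrak{B}^{*}(S^{*}(f))\circ\psi_{(A,F)}=\psi_{(B,G)}\circ f$. 3. If $(X,M)$ is a partition space, then the functions $\mathfrak{B}^{*}(\mathcal{C}_{(X,M)}):\mathfrak{B}^{*}(S^{*}(\mathfrak{B}^{*}(X,M)))\rightarrow\mathfrak{B}^{*}(X,M)$ and $\psi_{\mathfrak{B}^{*}(X,M)}:\mathfrak{B}^{*}(X,M)\rightarrow\mathfrak{B}^{*}(S^{*}(\mathfrak{B}^{*}(X,M)))$ are inverses of each other. 4. If $(B,F)$ is a stable Boolean partition algebra, then $S^{*}(\psi_{(B,F)}):S^{*}(\mathfrak{B}^{*}(S^{*}(B,F)))\rightarrow S^{*}(B,F)$ and $\mathcal{C}_{S^{*}(B,F)}:S^{*}(B,F)\rightarrow S^{*}(\mathfrak{B}^{*}(S^{*}(B,F)))$ are inverses of each other.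
   Context: Partitions. For a Boolean algebra $B$ (complement of $b$ written $b'$), a partition of $B$ is a subset $p\subseteq B\setminus\{0\}$ with $a\wedge b=0$ for distinct $a,b\in p$ and with least upper bound $\bigvee p=1$. $\mathbb{P}(B)$ is the set of all partitions of $B$, ordered by $p\preceq q$ iff for each $a\in p$ there is $b\in q$ with $a\leq b$; this $b$ is unique and is denoted $\phi_{p,q}(a)$. Under $\preceq$, $\mathbb{P}(B)$ is a meet-semilattice with $p\wedge q=\{a\wedge b\mid a\in p,b\in q,a\wedge b\neq 0\}$. A filter on $\mathbb{P}(B)$ is a nonempty subset closed under $\wedge$ and upward closed under $\preceq$ (it may be all of $\mathbb{P}(B)$). Boolean partition algebras. A Boolean partition algebra is a pair $(B,F)$ with $B$ a Boolean algebra and $F$ a filter on $\mathbb{P}(B)$ such that $\{b,b'\}\in F$ for each $b\in B\setminus\{0,1\}$. $\varprojlim F$ denotes the set of all families $(x_{p})_{p\in F}$ with $x_{p}\in p$ and $\phi_{p,q}(x_{p})=x_{q}$ whenever $p\preceq q$ in $F$. $(B,F)$ is stable if for each $b\in B\setminus\{0\}$ there are $(x_{p})_{p\in F}\in\varprojlim F$ and $p\in F$ with $x_{p}=b$. A partition homomorphism $f:(A,F)\to(B,G)$ is a Boolean algebra homomorphism $f:A\to B$ with $f[p]\setminus\{0\}\in G$ for each $p\in F$. Partition spaces. For a set $X$, partitions of the Boolean algebra of all subsets $P(X)$ are the usual partitions of the set $X$. A partition space is a pair $(X,M)$ with $M$ a filter on $\mathbb{P}(P(X))$ (equivalently, a non-Archimedean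 uniform space, i.e. one whose uniformity is generated by equivalence relations). A map $f:(X,M)\to(Y,N)$ is uniformly continuous iff $\{f^{-1}(R)\mid R\in Q\}\setminus\{\emptyset\}\in M$ for each $Q\in N$. The functors. For a Boolean partition algebra $(B,F)$, an $F$-ultrafilter is an ultrafilter $\mathcal{U}$ on $B$ with $|\mathcal{U}\cap p|=1$ for each $p\in F$; $S^{*}(B,F)$ is the set of all $F$-ultrafilters on $B$, and $\iota(a)=\{\mathcal{U}\in S^{*}(B,F)\mid a\in\mathcal{U}\}$ for $a\in B$. When $(B,F)$ is stable, $S^{*}(B,F)$ is given the partition space structure generated by $\{\iota[p]\mid p\in F\}$, i.e. the set of all partitions $Z$ of $S^{*}(B,F)$ with $\iota[p]\preceq Z$ for some $p\in F$. For a partition homomorphism $\phi:(A,F)\to(B,G)$, $S^{*}(\phi):S^{*}(B,G)\to S^{*}(A,F)$ is $S^{*}(\phi)(\mathcal{U})=\phi^{-1}(\mathcal{U})$. For a partition space $(X,M)$, $\mathfrak{B}^{*}(X,M)$ is the pair $(\{\emptyset\}\cup\bigcup M,\,M)$, where $\{\emptyset\}\cup\bigcup M$ is a subalgebra of $P(X)$; it is a stable Boolean partition algebra. For a uniformly continuous $f:(X,M)\to(Y,N)$, $\mathfrak{B}^{*}(f):\mathfrak{B}^{*}(Y,N)\to\mathfrak{B}^{*}(X,M)$ is $\mathfrak{B}^{*}(f)(R)=f^{-1}(R)$. The natural maps. For a stable Boolean partition algebra $(B,F)$, $\psi_{(B,F)}:(B,F)\to\mathfrak{B}^{*}(S^{*}(B,F))$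 is $\psi_{(B,F)}(b)=\iota(b)$. For a partition space $(X,M)$, $\mathcal{C}_{(X,M)}:(X,M)\to S^{*}(\mathfrak{B}^{*}(X,M))$ is $\mathcal{C}_{(X,M)}(x)=\{R\in\{\emptyset\}\cup\bigcup M\mid x\in R\}$. *)

theory Defs
  imports "HOL-Algebra.Lattice"
begin

section \<open>Boolean algebras\<close>

text \<open>
  Boolean algebras are carrier-based, because the algebra attached to a partition space
  \<open>X\<close> is a subalgebra of the power set of \<open>X\<close>. The trivial algebra is allowed.
\<close>

locale boolean_alg = bounded_lattice +
  assumes distrib: "\<lbrakk>x \<in> carrier L; y \<in> carrier L; z \<in> carrier L\<rbrakk>
      \<Longrightarrow> x \<sqinter> (y \<squnion> z) = (x \<sqinter> y) \<squnion> (x \<sqinter> z)"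
    and complemented: "x \<in> carrier L \<Longrightarrow> \<exists>y\<in>carrier L. x \<sqinter> y = \<bottom> \<and> x \<squnion> y = \<top>"

definition cmpl :: "'a gorder \<Rightarrow> 'a \<Rightarrow> 'a"
  where "cmpl B b = (THE c. c \<in> carrier B \<and> b \<sqinter>\<^bsub>B\<^esub> c = \<bottom>\<^bsub>B\<^esub> \<and> b \<squnion>\<^bsub>B\<^esub> c = \<top>\<^bsub>B\<^esub>)"

definition boolean_hom :: "'a gorder \<Rightarrow> 'b gorder \<Rightarrow> ('a \<Rightarrow> 'b) \<Rightarrow> bool"
  where "boolean_hom A B f \<longleftrightarrow>
     f \<in> carrier A \<rightarrow> carrier B \<and>
     f \<bottom>\<^bsub>A\<^esub> = \<bottom>\<^bsub>B\<^esub> \<and> f \<top>\<^bsub>A\<^esub> = \<top>\<^bsub>B\<^esub> \<and>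
     (\<forall>a\<in>carrier A. \<forall>b\<in>carrier A. f (a \<sqinter>\<^bsub>A\<^esub> b) = f a \<sqinter>\<^bsub>B\<^esub> f b) \<and>
     (\<forall>a\<in>carrier A. \<forall>b\<in>carrier A. f (a \<squnion>\<^bsub>A\<^esub> b) = f a \<squnion>\<^bsub>B\<^esub> f b) \<and>
     (\<forall>a\<in>carrier A. f (cmpl A a) = cmpl B (f a))"

definition set_algebra :: "'a set set \<Rightarrow> 'a set gorder"
  where "set_algebra S = \<lparr>carrier = S, eq = (=), le = (\<subseteq>)\<rparr>"

definition proper_filter :: "'a gorder \<Rightarrow> 'a set \<Rightarrow> bool"
  where "proper_filter B U \<longleftrightarrow>
     U \<subseteq> carrier B \<and> \<top>\<^bsub>B\<^esub> \<in> U \<and> \<bottom>\<^bsub>B\<^esub> \<notin> U \<and>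
     (\<forall>a\<in>U. \<forall>b\<in>U. a \<sqinter>\<^bsub>B\<^esub> b \<in> U) \<and>
     (\<forall>a\<in>U. \<forall>b\<in>carrier B. a \<sqsubseteq>\<^bsub>B\<^esub> b \<longrightarrow> b \<in> U)"

definition ultrafilter :: "'a gorder \<Rightarrow> 'a set \<Rightarrow> bool"
  where "ultrafilter B U \<longleftrightarrow>
     proper_filter B U \<and> (\<forall>V. proper_filter B V \<longrightarrow> U \<subseteq> V \<longrightarrow> V = U)"


section \<open>Partitions of a Boolean algebra\<close>

definition partitions :: "'a gorder \<Rightarrow> 'a set set"
  where "partitions B =
     {p. p \<subseteq> carrier B - {\<bottom>\<^bsub>B\<^esub>} \<and>
         (\<forall>a\<in>p. \<forall>b\<in>p. a \<noteq> b \<longrightarrow> a \<sqinter>\<^bsub>B\<^esub> b = \<bottom>\<^bsub>B\<^esub>) \<and>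
         least B \<top>\<^bsub>B\<^esub> (Upper B p)}"

definition refines :: "'a gorder \<Rightarrow> 'a set \<Rightarrow> 'a set \<Rightarrow> bool"
  where "refines B p q \<longleftrightarrow> (\<forall>a\<in>p. \<exists>b\<in>q. a \<sqsubseteq>\<^bsub>B\<^esub> b)"

definition refine_map :: "'a gorder \<Rightarrow> 'a set \<Rightarrow> 'a set \<Rightarrow> 'a \<Rightarrow> 'a"
  where "refine_map B p q = (\<lambda>a\<in>p. THE b. b \<in> q \<and> a \<sqsubseteq>\<^bsub>B\<^esub> b)"

definition partition_meet :: "'a gorder \<Rightarrow> 'a set \<Rightarrow> 'a set \<Rightarrow> 'a set"
  where "partition_meet B p q = {a \<sqinter>\<^bsub>B\<^esub> b | a b. a \<in> p \<and> b \<in> q \<and> a \<sqinter>\<^bsub>B\<^esub> b \<noteq> \<bottom>\<^bsub>B\<^esub>}"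

definition partition_filter :: "'a gorder \<Rightarrow> 'a set set \<Rightarrow> bool"
  where "partition_filter B F \<longleftrightarrow>
     F \<subseteq> partitions B \<and> F \<noteq> {} \<and>
     (\<forall>p\<in>F. \<forall>q\<in>F. partition_meet B p q \<in> F) \<and>
     (\<forall>p\<in>F. \<forall>q\<in>partitions B. refines B p q \<longrightarrow> q \<in> F)"


section \<open>Boolean partition algebras\<close>

type_synonym 'a partition_alg = "'a gorder \<times> 'a set set"

fun boolean_partition_alg :: "'a partition_alg \<Rightarrow> bool"
  where "boolean_partition_alg (B, F) \<longleftrightarrow>
     boolean_alg B \<and> partition_filter B F \<and>
     (\<forall>b \<in> carrier B - {\<bottom>\<^bsub>B\<^esub>, \<top>\<^bsub>B\<^esub>}. {b, cmpl B b} \<in> F)"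

fun inverse_limit :: "'a partition_alg \<Rightarrow> ('a set \<Rightarrow> 'a) set"
  where "inverse_limit (B, F) =
     {x \<in> (\<Pi>\<^sub>E p\<in>F. p). \<forall>p\<in>F. \<forall>q\<in>F. refines B p q \<longrightarrow> refine_map B p q (x p) = x q}"

fun stable_alg :: "'a partition_alg \<Rightarrow> bool"
  where "stable_alg (B, F) \<longleftrightarrow>
     (\<forall>b \<in> carrier B - {\<bottom>\<^bsub>B\<^esub>}. \<exists>x \<in> inverse_limit (B, F). \<exists>p\<in>F. x p = b)"

fun partition_hom :: "'a partition_alg \<Rightarrow> 'b partition_alg \<Rightarrow> ('a \<Rightarrow> 'b) \<Rightarrow> bool"
  where "partition_hom (A, F) (B, G) f \<longleftrightarrow>
     boolean_hom A B f \<and> (\<forall>p\<in>F. f ` p - {\<bottom>\<^bsub>B\<^esub>} \<in> G)"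


section \<open>Partition spaces\<close>

type_synonym 'a partition_sp = "'a set \<times> 'a set set set"

fun partition_space :: "'a partition_sp \<Rightarrow> bool"
  where "partition_space (X, M) \<longleftrightarrow> partition_filter (set_algebra (Pow X)) M"

fun unif_continuous :: "'a partition_sp \<Rightarrow> 'b partition_sp \<Rightarrow> ('a \<Rightarrow> 'b) \<Rightarrow> bool"
  where "unif_continuous (X, M) (Y, N) f \<longleftrightarrow>
     f \<in> X \<rightarrow> Y \<and> (\<forall>Q\<in>N. (\<lambda>R. f -` R \<inter> X) ` Q - {{}} \<in> M)"


section \<open>The functors and the natural maps\<close>

text \<open>
  The functors act on morphisms between explicitly given objects, and all maps below are
  restricted to (undefined outside) their domains. Equality of composites formed with
  \<^const>\<open>compose\<close> is thus equality of functions on the given domain.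
\<close>

fun F_ultrafilters :: "'a partition_alg \<Rightarrow> 'a set set"
  where "F_ultrafilters (B, F) = {U. ultrafilter B U \<and> (\<forall>p\<in>F. card (U \<inter> p) = 1)}"

definition iota :: "'a partition_alg \<Rightarrow> 'a \<Rightarrow> 'a set set"
  where "iota P a = {U \<in> F_ultrafilters P. a \<in> U}"

fun S_star :: "'a partition_alg \<Rightarrow> 'a set partition_sp"
  where "S_star (B, F) =
     (F_ultrafilters (B, F),
      {Z \<in> partitions (set_algebra (Pow (F_ultrafilters (B, F)))).
         \<exists>p\<in>F. refines (set_algebra (Pow (F_ultrafilters (B, F)))) (iota (B, F) ` p) Z})"

definition S_star_map ::
    "'a partition_alg \<Rightarrow> 'b partition_alg \<Rightarrow> ('a \<Rightarrow> 'b) \<Rightarrow> 'b set \<Rightarrow> 'a set"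
  where "S_star_map P Q f = (\<lambda>U \<in> F_ultrafilters Q. f -` U \<inter> carrier (fst P))"

fun B_star :: "'a partition_sp \<Rightarrow> 'a set partition_alg"
  where "B_star (X, M) = (set_algebra ({{}} \<union> \<Union> M), M)"

definition B_star_map ::
    "'a partition_sp \<Rightarrow> 'b partition_sp \<Rightarrow> ('a \<Rightarrow> 'b) \<Rightarrow> 'b set \<Rightarrow> 'a set"
  where "B_star_map S T f = (\<lambda>R \<in> carrier (fst (B_star T)). f -` R \<inter> fst S)"

definition psi :: "'a partition_alg \<Rightarrow> 'a \<Rightarrow> 'a set set"
  where "psi P = (\<lambda>b \<in> carrier (fst P). iota P b)"

definition C_map :: "'a partition_sp \<Rightarrow> 'a \<Rightarrow> 'a set set"
  where "C_map S = (\<lambda>x \<in> fst S. {R \<in> carrier (fst (B_star S)). x \<in> R})"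

definition mutually_inverse :: "'a set \<Rightarrow> 'b set \<Rightarrow> ('a \<Rightarrow> 'b) \<Rightarrow> ('b \<Rightarrow> 'a) \<Rightarrow> bool"
  where "mutually_inverse S T f g \<longleftrightarrow>
     f \<in> S \<rightarrow> T \<and> g \<in> T \<rightarrow> S \<and> (\<forall>x\<in>S. g (f x) = x) \<and> (\<forall>y\<in>T. f (g y) = y)"

end

theory Submission
  imports "HOL-Analysis.Sigma_Algebra" Defs
begin

text \<open>
  A proper filter meeting every \<open>p \<in> F\<close> is automatically an ultrafilter, since \<open>F\<close> contains
  all \<open>{b, b'}\<close>. Hence preimages of \<open>F\<close>-ultrafilters under partition homomorphisms are
  \<open>F\<close>-ultrafilters, points of a partition space yield \<open>M\<close>-ultrafilters, and a thread of the
  inverse limit generates an \<open>F\<close>-ultrafilter; by stability the latter makes \<open>\<iota>(b)\<close> nonempty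
  for \<open>b \<noteq> 0\<close>, so that \<open>\<iota>[p]\<close> is a partition of \<open>S\<^sup>*(B, F)\<close>. Which block of a
  partition coarser than \<open>\<iota>[p]\<close> contains an ultrafilter is decided by the unique member of
  \<open>p\<close> it selects, and this gives both pairs of inverse maps.
\<close>

section \<open>Algebras of sets\<close>

lemma set_algebra_simps [simp]:
  "carrier (set_algebra S) = S"
  "a \<sqsubseteq>\<^bsub>set_algebra S\<^esub> b \<longleftrightarrow> a \<subseteq> b"
  "a .=\<^bsub>set_algebra S\<^esub> b \<longleftrightarrow> a = b"
  by (simp_all add: set_algebra_def)

lemma refines_set_algebra [simp]:
  "Defs.refines (set_algebra S) p q \<longleftrightarrow> (\<forall>a\<in>p. \<exists>b\<in>q. a \<subseteq> b)"
  by (simp add: Defs.refines_def)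

text \<open>\<open>meet\<close> selects some greatest lower bound, so antisymmetry of inclusion is
  used to identify the choice. Membership of \<open>a \<inter> b\<close> in \<open>S\<close>
  matters: without it a meet in \<open>S\<close>, if it exists, is a strictly smaller set.\<close>

lemma meet_set_algebra:
  assumes "a \<in> S" "b \<in> S" "a \<inter> b \<in> S"
  shows "a \<sqinter>\<^bsub>set_algebra S\<^esub> b = a \<inter> b"
proof -
  have "a \<inter> b \<in> Lower (set_algebra S) {a, b}"
    using assms by (simp add: Lower_def)
  moreover have "l \<subseteq> a \<inter> b" if "l \<in> Lower (set_algebra S) {a, b}" for l
    using that assms by (simp add: Lower_def)
  ultimately have *: "greatest (set_algebra S) (a \<inter> b) (Lower (set_algebra S) {a, b})"
    using assms by (auto simp: greatest_def Lower_def Upper_def)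
  moreover have "c = a \<inter> b" if "greatest (set_algebra S) c (Lower (set_algebra S) {a, b})" for c
    using that * unfolding greatest_def set_algebra_simps by (meson subset_antisym)
  ultimately show ?thesis
    unfolding meet_def Lattice.inf_def by (intro some_equality)
qed

lemma join_set_algebra:
  assumes "a \<in> S" "b \<in> S" "a \<union> b \<in> S"
  shows "a \<squnion>\<^bsub>set_algebra S\<^esub> b = a \<union> b"
proof -
  have "a \<union> b \<in> Upper (set_algebra S) {a, b}"
    using assms by (simp add: Upper_def)
  moreover have "a \<union> b \<subseteq> u" if "u \<in> Upper (set_algebra S) {a, b}" for u
    using that assms by (simp add: Upper_def)
  ultimately have *: "least (set_algebra S) (a \<union> b) (Upper (set_algebra S) {a, b})"
    using assms by (auto simp: least_def Lower_def Upper_def)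
  moreover have "c = a \<union> b" if "least (set_algebra S) c (Upper (set_algebra S) {a, b})" for c
    using that * unfolding least_def set_algebra_simps by (meson subset_antisym)
  ultimately show ?thesis
    unfolding join_def Lattice.sup_def by (intro some_equality)
qed

lemma bottom_set_algebra: "{} \<in> S \<Longrightarrow> \<bottom>\<^bsub>set_algebra S\<^esub> = {}"
  unfolding bottom_def by (rule some_equality) (auto simp: least_def)

lemma top_set_algebra: "X \<in> S \<Longrightarrow> S \<subseteq> Pow X \<Longrightarrow> \<top>\<^bsub>set_algebra S\<^esub> = X"
  unfolding top_def by (rule some_equality) (auto simp: greatest_def)

section \<open>Boolean operations and partitions in an algebra of sets\<close>

context algebra
begin

lemma meet_sets: "a \<in> M \<Longrightarrow> b \<in> M \<Longrightarrow> a \<sqinter>\<^bsub>set_algebra M\<^esub> b = a \<inter> b"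
  by (simp add: meet_set_algebra Int)

lemma join_sets: "a \<in> M \<Longrightarrow> b \<in> M \<Longrightarrow> a \<squnion>\<^bsub>set_algebra M\<^esub> b = a \<union> b"
  by (simp add: join_set_algebra Un)

lemma bottom_sets: "\<bottom>\<^bsub>set_algebra M\<^esub> = {}"
  by (simp add: bottom_set_algebra)

lemma top_sets: "\<top>\<^bsub>set_algebra M\<^esub> = \<Omega>"
  using space_closed by (simp add: top_set_algebra)

lemma boolean_alg_sets: "boolean_alg (set_algebra M)"
proof -
  have lub: "\<exists>s. least (set_algebra M) s (Upper (set_algebra M) {a, b})"
    if "a \<in> M" "b \<in> M" for a b
    by (rule exI[of _ "a \<union> b"]) (use that in \<open>auto simp: least_def Upper_def\<close>)
  have glb: "\<exists>s. greatest (set_algebra M) s (Lower (set_algebra M) {a, b})"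
    if "a \<in> M" "b \<in> M" for a b
    by (rule exI[of _ "a \<inter> b"]) (use that in \<open>auto simp: greatest_def Lower_def\<close>)
  show ?thesis
  proof (unfold_locales, simp_all add: lub glb fun_eq_iff)
    show "\<exists>x. least (set_algebra M) x M"
      by (rule exI[of _ "{}"]) (auto simp: least_def)
    show "\<exists>x. greatest (set_algebra M) x M"
      by (rule exI[of _ \<Omega>]) (use space_closed in \<open>auto simp: greatest_def\<close>)
    show "a \<sqinter>\<^bsub>set_algebra M\<^esub> (b \<squnion>\<^bsub>set_algebra M\<^esub> c) =
        a \<sqinter>\<^bsub>set_algebra M\<^esub> b \<squnion>\<^bsub>set_algebra M\<^esub> (a \<sqinter>\<^bsub>set_algebra M\<^esub> c)"
      if "a \<in> M" "b \<in> M" "c \<in> M" for a b c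
      using that by (auto simp: meet_sets join_sets Int Un)
    show "\<exists>b\<in>M. a \<sqinter>\<^bsub>set_algebra M\<^esub> b = \<bottom>\<^bsub>set_algebra M\<^esub> \<and>
        a \<squnion>\<^bsub>set_algebra M\<^esub> b = \<top>\<^bsub>set_algebra M\<^esub>"
      if "a \<in> M" for a
      by (rule bexI[of _ "\<Omega> - a"])
        (use that sets_into_space[OF that] in
          \<open>auto simp: compl_sets meet_sets join_sets bottom_sets top_sets\<close>)
  qed
qed

lemma cmpl_sets: "a \<in> M \<Longrightarrow> cmpl (set_algebra M) a = \<Omega> - a"
  unfolding cmpl_def
  by (rule the_equality)
    (auto simp: compl_sets meet_sets join_sets bottom_sets top_sets dest: sets_into_space)

text \<open>Every upper bound of \<open>p\<close> in \<open>M\<close> contains the union of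
  \<open>p\<close>, which is the whole space. The converse fails in a general subalgebra, where a
  least upper bound may exceed the union.\<close>

lemma partition_on_imp_partitions:
  assumes "partition_on \<Omega> p" "p \<subseteq> M"
  shows "p \<in> partitions (set_algebra M)"
proof -
  have "least (set_algebra M) \<Omega> (Upper (set_algebra M) p)"
    using partition_onD1[OF assms(1)] assms(2) top by (auto simp: least_def Upper_def)
  moreover have "a \<inter> b = {}" if "a \<in> p" "b \<in> p" "a \<noteq> b" for a b
    using partition_onD2[OF assms(1)] that by (auto simp: disjoint_def)
  ultimately show ?thesis
    using assms(2) partition_onD3[OF assms(1)]
    by (auto simp: partitions_def bottom_sets top_sets meet_sets subset_iff)
qed

end

text \<open>Covering passes from a partition to any family that it refines. This later recovers
  covering for partitions of an algebra of blocks, where a least upper bound is not visibly a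
  union.\<close>

lemma partition_on_refined:
  assumes "partition_on X p" "q \<subseteq> Pow X" "{} \<notin> q"
    and "\<And>a b. a \<in> q \<Longrightarrow> b \<in> q \<Longrightarrow> a \<noteq> b \<Longrightarrow> a \<inter> b = {}"
    and "\<forall>a\<in>p. \<exists>b\<in>q. a \<subseteq> b"
  shows "partition_on X q"
proof (rule partition_onI)
  show "\<Union>q = X"
    using assms(2,5) partition_onD1[OF assms(1)] by blast
qed (use assms in \<open>auto simp: disjnt_def\<close>)

lemma partition_on_subset_Pow: "partition_on X p \<Longrightarrow> p \<subseteq> Pow X"
  by (auto simp: partition_on_def)

lemma algebra_Pow: "algebra X (Pow X)"
  by (auto simp: algebra_iff_Int)

text \<open>In the full power set the union is itself an upper bound, so \<open>X\<close> being the
  least one forces covering.\<close>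

lemma partitions_Pow: "partitions (set_algebra (Pow X)) = {p. partition_on X p}"
proof (intro equalityI subsetI CollectI)
  fix p assume p: "p \<in> partitions (set_algebra (Pow X))"
  interpret algebra X "Pow X" by (rule algebra_Pow)
  have pX: "p \<subseteq> Pow X" and "{} \<notin> p"
    and disj: "\<And>a b. a \<in> p \<Longrightarrow> b \<in> p \<Longrightarrow> a \<noteq> b \<Longrightarrow> a \<sqinter>\<^bsub>set_algebra (Pow X)\<^esub> b = {}"
    and lub: "least (set_algebra (Pow X)) X (Upper (set_algebra (Pow X)) p)"
    using p by (auto simp: partitions_def bottom_sets top_sets)
  have "\<Union>p \<in> Upper (set_algebra (Pow X)) p"
    using pX by (auto simp: Upper_def)
  then have "\<Union>p = X"
    using lub pX by (auto simp: least_def)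
  moreover have "disjnt a b" if "a \<in> p" "b \<in> p" "a \<noteq> b" for a b
  proof -
    have "a \<sqinter>\<^bsub>set_algebra (Pow X)\<^esub> b = a \<inter> b"
      by (rule meet_sets) (use that pX in auto)
    then show ?thesis using disj[OF that] by (simp add: disjnt_def)
  qed
  ultimately show "partition_on X p"
    using \<open>{} \<notin> p\<close> by (auto intro: partition_onI)
next
  fix p assume "p \<in> {p. partition_on X p}"
  then show "p \<in> partitions (set_algebra (Pow X))"
    by (simp add: algebra.partition_on_imp_partitions[OF algebra_Pow] partition_on_subset_Pow)
qed

lemma partition_on_unique:
  "partition_on X p \<Longrightarrow> a \<in> p \<Longrightarrow> b \<in> p \<Longrightarrow> x \<in> a \<Longrightarrow> x \<in> b \<Longrightarrow> a = b"
  by (auto simp: partition_on_def disjoint_def)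

lemma partition_on_preimage:
  assumes "partition_on Y q" "f \<in> X \<rightarrow> Y"
  shows "partition_on X ((\<lambda>R. f -` R \<inter> X) ` q - {{}})"
proof -
  have "partition_on (f -` Y \<inter> X) ((\<lambda>R. f -` R \<inter> X) ` q - {{}})"
    by (rule partition_on_transform[OF assms(1)]) (auto simp: disjnt_def)
  moreover have "f -` Y \<inter> X = X" using assms(2) by auto
  ultimately show ?thesis by simp
qed

text \<open>The common refinement without an ambient algebra, so that one set serves both for
  \<open>Pow X\<close> and for the algebra of blocks.\<close>

definition set_meet :: "'a set set \<Rightarrow> 'a set set \<Rightarrow> 'a set set"
  where "set_meet p q = {a \<inter> b | a b. a \<in> p \<and> b \<in> q \<and> a \<inter> b \<noteq> {}}"

lemma partition_on_set_meet:
  assumes "partition_on X p" "partition_on X q"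
  shows "partition_on X (set_meet p q)"
proof (rule partition_onI)
  show "\<Union>(set_meet p q) = X"
  proof (intro equalityI subsetI)
    fix x assume "x \<in> X"
    then obtain a b where "a \<in> p" "b \<in> q" "x \<in> a" "x \<in> b"
      using partition_onD1[OF assms(1)] partition_onD1[OF assms(2)] by blast
    then show "x \<in> \<Union>(set_meet p q)" unfolding set_meet_def by blast
  qed (use partition_onD1[OF assms(1)] in \<open>auto simp: set_meet_def\<close>)
  show "{} \<notin> set_meet p q" by (auto simp: set_meet_def)
  fix c d assume "c \<in> set_meet p q" "d \<in> set_meet p q" "c \<noteq> d"
  then show "disjnt c d"
    using partition_on_unique[OF assms(1)] partition_on_unique[OF assms(2)]
    unfolding set_meet_def disjnt_def by blast
qed

lemma (in algebra) partition_meet_sets: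
  assumes "p \<subseteq> M" "q \<subseteq> M"
  shows "partition_meet (set_algebra M) p q = set_meet p q"
proof -
  have "a \<sqinter>\<^bsub>set_algebra M\<^esub> b = a \<inter> b" if "a \<in> p" "b \<in> q" for a b
    using that assms meet_sets by blast
  then show ?thesis
    unfolding partition_meet_def set_meet_def bottom_sets by (intro Collect_cong) metis
qed

text \<open>Puts the filter conditions in terms of \<open>partition_on\<close> and inclusion, so
  that later proofs avoid the choice-based lattice operations.\<close>

lemma partition_space_iff:
  "partition_space (X, M) \<longleftrightarrow>
     (\<forall>p\<in>M. partition_on X p) \<and> M \<noteq> {} \<and> (\<forall>p\<in>M. \<forall>q\<in>M. set_meet p q \<in> M) \<and>
     (\<forall>p\<in>M. \<forall>q. partition_on X q \<longrightarrow> (\<forall>a\<in>p. \<exists>b\<in>q. a \<subseteq> b) \<longrightarrow> q \<in> M)"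
proof -
  have *: "partition_meet (set_algebra (Pow X)) p q = set_meet p q"
    if "partition_on X p" "partition_on X q" for p q
    using that by (simp add: algebra.partition_meet_sets[OF algebra_Pow] partition_on_subset_Pow)
  have "M \<subseteq> {p. partition_on X p} \<longleftrightarrow> (\<forall>p\<in>M. partition_on X p)" by blast
  then show ?thesis
    unfolding partition_space.simps partition_filter_def partitions_Pow refines_set_algebra
    by (simp add: * cong: conj_cong)
qed


section \<open>Partition algebras and their ultrafilters\<close>

context boolean_alg
begin

lemma bottom_eq_of_le: "x \<in> carrier L \<Longrightarrow> x \<sqsubseteq> \<bottom> \<Longrightarrow> x = \<bottom>"
  by (rule le_antisym) simp_all

text \<open>By distributivity, anything disjoint from \<open>x\<close> lies below anything whose
  join with \<open>x\<close> is top; using this in both directions gives equality. Uniqueness is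
  what gives the description in \<open>cmpl\<close> its meaning.\<close>

lemma cmpl_unique:
  assumes "x \<in> carrier L" "y \<in> carrier L" "z \<in> carrier L"
    and "x \<sqinter> y = \<bottom>" "x \<squnion> y = \<top>" "x \<sqinter> z = \<bottom>" "x \<squnion> z = \<top>"
  shows "y = z"
proof -
  have le: "u \<sqsubseteq> v" if "u \<in> carrier L" "v \<in> carrier L" "x \<sqinter> u = \<bottom>" "x \<squnion> v = \<top>" for u v
  proof -
    \<comment> \<open>Here \<open>le_iff_join\<close> expresses the order by a meet, and
      \<open>le_iff_meet\<close> expresses it by a join.\<close>
    have "u = u \<sqinter> \<top>"
      using le_iff_join[of u \<top>] that(1) by simp
    also have "\<dots> = (u \<sqinter> x) \<squnion> (u \<sqinter> v)"
      using distrib[of u x v] that assms(1) by simp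
    also have "\<dots> = u \<sqinter> v"
      using that assms(1) le_iff_meet[of \<bottom> "u \<sqinter> v"] by (simp add: meet_comm)
    finally show ?thesis using meet_right[of u v] that by simp
  qed
  show ?thesis using le[of y z] le[of z y] assms by auto
qed

end

lemma cmpl:
  fixes B :: "'a gorder" (structure)
  assumes "boolean_alg B" "x \<in> carrier B"
  shows "cmpl B x \<in> carrier B" "x \<sqinter> cmpl B x = \<bottom>" "x \<squnion> cmpl B x = \<top>"
proof -
  interpret boolean_alg B by (rule assms(1))
  have "\<exists>!c. c \<in> carrier B \<and> x \<sqinter> c = \<bottom> \<and> x \<squnion> c = \<top>"
    using complemented[OF assms(2)] cmpl_unique[OF assms(2)] by blast
  from theI'[OF this]
  show "cmpl B x \<in> carrier B" "x \<sqinter> cmpl B x = \<bottom>" "x \<squnion> cmpl B x = \<top>"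
    by (auto simp: cmpl_def)
qed

text \<open>Complements are preserved automatically: the image of a complement satisfies the two
  equations that determine the complement of the image.\<close>

lemma boolean_homI:
  assumes "boolean_alg A" "boolean_alg B" "f \<in> carrier A \<rightarrow> carrier B"
    and bt: "f \<bottom>\<^bsub>A\<^esub> = \<bottom>\<^bsub>B\<^esub>" "f \<top>\<^bsub>A\<^esub> = \<top>\<^bsub>B\<^esub>"
    and meet: "\<And>a b. a \<in> carrier A \<Longrightarrow> b \<in> carrier A \<Longrightarrow> f (a \<sqinter>\<^bsub>A\<^esub> b) = f a \<sqinter>\<^bsub>B\<^esub> f b"
    and join: "\<And>a b. a \<in> carrier A \<Longrightarrow> b \<in> carrier A \<Longrightarrow> f (a \<squnion>\<^bsub>A\<^esub> b) = f a \<squnion>\<^bsub>B\<^esub> f b"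
  shows "boolean_hom A B f"
proof -
  have "f (cmpl A a) = cmpl B (f a)" if a: "a \<in> carrier A" for a
  proof -
    have fa: "f a \<in> carrier B" "f (cmpl A a) \<in> carrier B"
      using a cmpl(1)[OF assms(1) a] assms(3) by auto
    have "f a \<sqinter>\<^bsub>B\<^esub> f (cmpl A a) = \<bottom>\<^bsub>B\<^esub>" "f a \<squnion>\<^bsub>B\<^esub> f (cmpl A a) = \<top>\<^bsub>B\<^esub>"
      using meet[OF a cmpl(1)[OF assms(1) a]] join[OF a cmpl(1)[OF assms(1) a]]
        cmpl(2,3)[OF assms(1) a] bt by simp_all
    then show ?thesis
      using boolean_alg.cmpl_unique[OF assms(2) fa(1) fa(2) cmpl(1)[OF assms(2) fa(1)]]
        cmpl(2,3)[OF assms(2) fa(1)] by simp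
  qed
  then show ?thesis using assms by (simp add: boolean_hom_def)
qed

declare F_ultrafilters.simps [simp del]

locale partition_algebra = boolean_alg B for B :: "'a gorder" (structure) +
  fixes F :: "'a set set"
  assumes bpa: "boolean_partition_alg (B, F)"
begin

lemma partition_filter: "partition_filter B F"
  using bpa by simp

lemma partition:
  assumes "p \<in> F"
  shows "p \<subseteq> carrier B" "\<bottom> \<notin> p" "a \<in> p \<Longrightarrow> b \<in> p \<Longrightarrow> a \<noteq> b \<Longrightarrow> a \<sqinter> b = \<bottom>"
  using partition_filter assms by (auto simp: partition_filter_def partitions_def)

lemma cmpl_partition: "b \<in> carrier B \<Longrightarrow> b \<noteq> \<bottom> \<Longrightarrow> b \<noteq> \<top> \<Longrightarrow> {b, cmpl B b} \<in> F"
  using bpa by simp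

text \<open>If a proper filter \<open>V\<close> above \<open>U\<close> contains \<open>b\<close>,
  then \<open>U\<close> selects \<open>b\<close> or its complement, and the complement would put
  bottom into \<open>V\<close>. Likewise two distinct selected members of one partition would have
  meet bottom, whence cardinality 1.\<close>

lemma F_ultrafilters_iff:
  "U \<in> F_ultrafilters (B, F) \<longleftrightarrow> proper_filter B U \<and> (\<forall>p\<in>F. U \<inter> p \<noteq> {})"
proof
  assume "U \<in> F_ultrafilters (B, F)"
  then show "proper_filter B U \<and> (\<forall>p\<in>F. U \<inter> p \<noteq> {})"
    by (auto simp: F_ultrafilters.simps ultrafilter_def)
next
  assume asm: "proper_filter B U \<and> (\<forall>p\<in>F. U \<inter> p \<noteq> {})"
  have "V \<subseteq> U" if V: "proper_filter B V" "U \<subseteq> V" for V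
  proof
    fix b assume b: "b \<in> V"
    then have bB: "b \<in> carrier B - {\<bottom>}" using V(1) by (auto simp: proper_filter_def)
    show "b \<in> U"
    proof (cases "b = \<top>")
      case True
      then show ?thesis using asm by (simp add: proper_filter_def)
    next
      case False
      then have "U \<inter> {b, cmpl B b} \<noteq> {}" using asm bB cmpl_partition by blast
      moreover have "cmpl B b \<notin> V"
        using cmpl(2)[OF boolean_alg_axioms, of b] V(1) b bB
        unfolding proper_filter_def by (metis Diff_iff)
      ultimately show ?thesis using V(2) by auto
    qed
  qed
  then have "ultrafilter B U"
    using asm unfolding ultrafilter_def by blast
  moreover have "card (U \<inter> p) = 1" if p: "p \<in> F" for p
  proof -
    have "a = b" if "a \<in> U \<inter> p" "b \<in> U \<inter> p" for a b
      using partition(3)[OF p, of a b] that asm unfolding proper_filter_def by (metis IntD1 IntD2)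
    moreover obtain a where "a \<in> U \<inter> p" using asm p by blast
    ultimately have "U \<inter> p = {a}" by blast
    then show ?thesis by simp
  qed
  ultimately show "U \<in> F_ultrafilters (B, F)" by (simp add: F_ultrafilters.simps)
qed

context
  fixes U assumes U: "U \<in> F_ultrafilters (B, F)"
begin

lemma F_ultrafilter_subset: "U \<subseteq> carrier B"
  and F_ultrafilter_top: "\<top> \<in> U"
  and F_ultrafilter_bottom: "\<bottom> \<notin> U"
  and F_ultrafilter_up: "a \<in> U \<Longrightarrow> b \<in> carrier B \<Longrightarrow> a \<sqsubseteq> b \<Longrightarrow> b \<in> U"
  using U by (auto simp: F_ultrafilters_iff proper_filter_def)

lemma F_ultrafilter_block: "p \<in> F \<Longrightarrow> \<exists>a\<in>p. a \<in> U"
  using U by (auto simp: F_ultrafilters_iff)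

lemma F_ultrafilter_meet_iff:
  assumes "a \<in> carrier B" "b \<in> carrier B"
  shows "a \<sqinter> b \<in> U \<longleftrightarrow> a \<in> U \<and> b \<in> U"
proof
  assume "a \<sqinter> b \<in> U"
  then show "a \<in> U \<and> b \<in> U"
    using assms F_ultrafilter_up meet_left meet_right by blast
next
  assume "a \<in> U \<and> b \<in> U"
  then show "a \<sqinter> b \<in> U"
    using U by (simp add: F_ultrafilters_iff proper_filter_def)
qed

text \<open>Primeness: if \<open>U\<close> selects the complement of \<open>a\<close>, then meeting
  it with \<open>a \<squnion> b\<close> leaves an element of \<open>U\<close> below
  \<open>b\<close>.\<close>

lemma F_ultrafilter_join_iff:
  assumes "a \<in> carrier B" "b \<in> carrier B"
  shows "a \<squnion> b \<in> U \<longleftrightarrow> a \<in> U \<or> b \<in> U"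
proof
  assume ab: "a \<squnion> b \<in> U"
  show "a \<in> U \<or> b \<in> U"
  \<comment> \<open>\<open>F\<close> is only assumed to contain the pair
    \<open>{a, cmpl B a}\<close> for \<open>a\<close> different from bottom and top.\<close>
  proof (cases "a = \<bottom> \<or> a = \<top>")
    case True
    then show ?thesis
      using ab assms F_ultrafilter_top le_iff_meet[of \<bottom> b] by auto
  next
    case False
    then have "{a, cmpl B a} \<in> F" using assms cmpl_partition by blast
    then consider "a \<in> U" | "cmpl B a \<in> U" using F_ultrafilter_block by blast
    then show ?thesis
    proof cases
      case 2
      let ?c = "cmpl B a"
      have c: "?c \<in> carrier B" "a \<sqinter> ?c = \<bottom>"
        using cmpl[OF boolean_alg_axioms assms(1)] by auto
      have "?c \<sqinter> (a \<squnion> b) = (?c \<sqinter> a) \<squnion> (?c \<sqinter> b)"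
        using distrib c(1) assms by blast
      also have "\<dots> = ?c \<sqinter> b"
        using c assms le_iff_meet[of \<bottom> "?c \<sqinter> b"] by (simp add: meet_comm)
      finally have "?c \<sqinter> b \<in> U" using 2 ab F_ultrafilter_meet_iff[of ?c "a \<squnion> b"] c(1) assms
        by simp
      then show ?thesis using F_ultrafilter_meet_iff c(1) assms by blast
    qed simp
  qed
next
  assume "a \<in> U \<or> b \<in> U"
  then show "a \<squnion> b \<in> U"
    using assms F_ultrafilter_up[of _ "a \<squnion> b"] join_left[of a b] join_right[of a b] by auto
qed

end

end

lemma partition_algebraI: "boolean_partition_alg (B, F) \<Longrightarrow> partition_algebra B F"
  by (simp add: partition_algebra_def partition_algebra_axioms_def)

section \<open>Stable algebras: threads of the inverse limit and nonemptiness of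
  \<open>iota\<close>\<close>

locale stable_partition_algebra = partition_algebra +
  assumes stable: "stable_alg (B, F)"
begin

text \<open>The value of a thread at \<open>p\<close> lies in \<open>p\<close>, so stability makes
  the partitions in \<open>F\<close> exhaust the nonzero elements.\<close>

lemma in_some_partition:
  assumes "b \<in> carrier B" "b \<noteq> \<bottom>"
  shows "\<exists>p\<in>F. b \<in> p"
proof -
  from stable assms obtain x p where "x \<in> inverse_limit (B, F)" "p \<in> F" "x p = b"
    by (metis Diff_iff singletonD stable_alg.simps)
  then show ?thesis by (auto simp: PiE_iff)
qed

text \<open>The witness is the upward closure of the values of a thread through \<open>b\<close>. It
  is closed under meets because the value at a common refinement lies below the values at both
  partitions.\<close>

lemma iota_nonempty:
  assumes b: "b \<in> carrier B" "b \<noteq> \<bottom>"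
  shows "iota (B, F) b \<noteq> {}"
proof -
  from stable b obtain x p where x: "x \<in> inverse_limit (B, F)" and p: "p \<in> F" "x p = b"
    by (metis Diff_iff singletonD stable_alg.simps)
  have xq: "x q \<in> q" if "q \<in> F" for q using x that by (auto simp: PiE_iff)
  have xB: "x q \<in> carrier B" "x q \<noteq> \<bottom>" if "q \<in> F" for q
    using partition(1,2)[OF that] xq[OF that] by auto
  \<comment> \<open>The compatibility of the thread speaks of a description in
    \<open>refine_map\<close>; it yields an inequality once that block is known to be unique. Two
    distinct blocks above \<open>x r\<close> would force \<open>x r\<close> to be bottom.\<close>
  have mono: "x r \<sqsubseteq> x q" if r: "r \<in> F" "q \<in> F" "Defs.refines B r q" for r q
  proof -
    have "refine_map B r q (x r) = x q" using x r by auto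
    then have "x q = (THE c. c \<in> q \<and> x r \<sqsubseteq> c)"
      using xq[OF r(1)] by (simp add: refine_map_def)
    moreover have "\<exists>!c. c \<in> q \<and> x r \<sqsubseteq> c"
    proof (rule ex_ex1I)
      show "\<exists>c. c \<in> q \<and> x r \<sqsubseteq> c" using r(3) xq[OF r(1)] unfolding Defs.refines_def by blast
      fix c d assume cd: "c \<in> q \<and> x r \<sqsubseteq> c" "d \<in> q \<and> x r \<sqsubseteq> d"
      have cdB: "c \<in> carrier B" "d \<in> carrier B" using cd partition(1)[OF r(2)] by auto
      have "x r \<sqsubseteq> c \<sqinter> d"
        using cd cdB xB[OF r(1)] by (simp add: meet_le)
      then show "c = d"
        using partition(3)[OF r(2), of c d] cd xB[OF r(1)] bottom_eq_of_le[of "x r"] by auto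
    qed
    ultimately show ?thesis using theI'[of "\<lambda>c. c \<in> q \<and> x r \<sqsubseteq> c"] by simp
  qed
  define U where "U = {c \<in> carrier B. \<exists>q\<in>F. x q \<sqsubseteq> c}"
  have "proper_filter B U"
    unfolding proper_filter_def
  proof (intro conjI ballI impI)
    show "U \<subseteq> carrier B" by (auto simp: U_def)
    show "\<top> \<in> U" using p(1) xB[OF p(1)] top_higher by (auto simp: U_def)
    show "\<bottom> \<notin> U"
      using xB bottom_eq_of_le unfolding U_def by blast
  next
    fix c d assume "c \<in> U" "d \<in> U"
    then obtain q r where cd: "c \<in> carrier B" "d \<in> carrier B"
      and qr: "q \<in> F" "r \<in> F" "x q \<sqsubseteq> c" "x r \<sqsubseteq> d"
      by (auto simp: U_def)
    let ?m = "partition_meet B q r"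
    have m: "?m \<in> F" using partition_filter qr unfolding partition_filter_def by blast
    have sub: "a \<in> carrier B" "b \<in> carrier B" if "a \<in> q" "b \<in> r" for a b
      using that partition(1)[OF qr(1)] partition(1)[OF qr(2)] by auto
    have "\<exists>b\<in>q. a \<sqsubseteq> b" "\<exists>b\<in>r. a \<sqsubseteq> b" if "a \<in> ?m" for a
    proof -
      from that obtain b c where bc: "a = b \<sqinter> c" "b \<in> q" "c \<in> r"
        unfolding partition_meet_def by blast
      show "\<exists>b\<in>q. a \<sqsubseteq> b" "\<exists>b\<in>r. a \<sqsubseteq> b"
        using bc sub meet_left[of b c] meet_right[of b c] by auto
    qed
    then have "Defs.refines B ?m q" "Defs.refines B ?m r"
      by (simp_all add: Defs.refines_def)
    then have "x ?m \<sqsubseteq> x q" "x ?m \<sqsubseteq> x r" using mono[OF m] qr by simp_all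
    then have "x ?m \<sqsubseteq> c" "x ?m \<sqsubseteq> d"
      using le_trans[of "x ?m" "x q" c] le_trans[of "x ?m" "x r" d] qr cd xB m by simp_all
    then have "x ?m \<sqsubseteq> c \<sqinter> d" using xB[OF m] cd by (simp add: meet_le)
    then show "c \<sqinter> d \<in> U" using m cd unfolding U_def by auto
  next
    fix c d assume "c \<in> U" "d \<in> carrier B" "c \<sqsubseteq> d"
    then show "d \<in> U" using le_trans[of _ c d] xB unfolding U_def by blast
  qed
  moreover have xU: "x q \<in> U" if "q \<in> F" for q
    using that xB[OF that] unfolding U_def by auto
  ultimately have "U \<in> F_ultrafilters (B, F)"
    using xq unfolding F_ultrafilters_iff by blast
  then show ?thesis using xU[OF p(1)] p(2) unfolding iota_def by blast
qed

text \<open>Every \<open>F\<close>-ultrafilter selects a member of \<open>p\<close>, which gives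
  covering, and disjoint elements have disjoint images. Stability enters through nonemptiness of the
  images.\<close>

lemma partition_on_iota:
  assumes p: "p \<in> F"
  shows "partition_on (F_ultrafilters (B, F)) (iota (B, F) ` p)"
proof (rule partition_onI)
  show "\<Union>(iota (B, F) ` p) = F_ultrafilters (B, F)"
    using F_ultrafilter_block[OF _ p] unfolding iota_def by blast
  show "{} \<notin> iota (B, F) ` p"
  proof
    assume "{} \<in> iota (B, F) ` p"
    then obtain a where a: "a \<in> p" "iota (B, F) a = {}" by auto
    then have "a \<in> carrier B" "a \<noteq> \<bottom>" using partition(1,2)[OF p] by auto
    then show False using iota_nonempty a(2) by simp
  qed
  fix y z assume yz: "y \<in> iota (B, F) ` p" "z \<in> iota (B, F) ` p" "y \<noteq> z"
  then obtain a b where ab: "a \<in> p" "b \<in> p" "y = iota (B, F) a" "z = iota (B, F) b" by auto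
  then have "a \<sqinter> b = \<bottom>" "a \<in> carrier B" "b \<in> carrier B"
    using partition(1)[OF p] partition(3)[OF p, of a b] yz(3) by auto
  then have "\<not> (a \<in> U \<and> b \<in> U)" if "U \<in> F_ultrafilters (B, F)" for U
    using F_ultrafilter_meet_iff[OF that, of a b] F_ultrafilter_bottom[OF that] by simp
  then show "disjnt y z"
    unfolding ab(3,4) disjnt_def iota_def by blast
qed

end

lemma stable_partition_algebraI:
  "boolean_partition_alg (B, F) \<Longrightarrow> stable_alg (B, F) \<Longrightarrow> stable_partition_algebra B F"
  by (intro stable_partition_algebra.intro stable_partition_algebra_axioms.intro
      partition_algebraI)


section \<open>Partition spaces\<close>

declare B_star.simps [simp del] S_star.simps [simp del]

text \<open>The carrier of \<open>B_star (X, M)\<close>, which depends on \<open>M\<close> alone.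
  The empty set is added because partitions have no empty members.\<close>

definition blocks :: "'a set set set \<Rightarrow> 'a set set"
  where "blocks M = {{}} \<union> \<Union>M"

lemma blocksI: "p \<in> M \<Longrightarrow> R \<in> p \<Longrightarrow> R \<in> blocks M"
  by (auto simp: blocks_def)

lemma empty_in_blocks: "{} \<in> blocks M"
  by (simp add: blocks_def)

lemma blocks_cases:
  assumes "R \<in> blocks M"
  obtains "R = {}" | p where "p \<in> M" "R \<in> p"
  using assms by (auto simp: blocks_def)

lemma B_star_eq: "B_star (X, M) = (set_algebra (blocks M), M)"
  by (simp add: B_star.simps blocks_def)

lemma (in algebra) proper_filter_sets:
  "proper_filter (set_algebra M) U \<longleftrightarrow>
     U \<subseteq> M \<and> \<Omega> \<in> U \<and> {} \<notin> U \<and> (\<forall>a\<in>U. \<forall>b\<in>U. a \<inter> b \<in> U) \<and>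
     (\<forall>a\<in>U. \<forall>b\<in>M. a \<subseteq> b \<longrightarrow> b \<in> U)"
proof -
  have "a \<sqinter>\<^bsub>set_algebra M\<^esub> b = a \<inter> b" if "U \<subseteq> M" "a \<in> U" "b \<in> U" for a b
    using that by (intro meet_sets) blast+
  then show ?thesis
    unfolding proper_filter_def bottom_sets top_sets set_algebra_simps
    by (simp cong: conj_cong ball_cong)
qed

section \<open>The algebra of blocks of a partition space and its stability\<close>

locale partition_sp =
  fixes X :: "'a set" and M :: "'a set set set"
  assumes space: "partition_space (X, M)"
begin

lemma partition_on: "p \<in> M \<Longrightarrow> partition_on X p"
  using space unfolding partition_space_iff by blast

lemma partition_exists: "\<exists>p. p \<in> M"
  using space unfolding partition_space_iff by blast

lemma set_meet_in: "p \<in> M \<Longrightarrow> q \<in> M \<Longrightarrow> set_meet p q \<in> M"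
  using space unfolding partition_space_iff by blast

lemma coarsen: "p \<in> M \<Longrightarrow> partition_on X q \<Longrightarrow> (\<And>a. a \<in> p \<Longrightarrow> \<exists>b\<in>q. a \<subseteq> b) \<Longrightarrow> q \<in> M"
  using space unfolding partition_space_iff by blast

lemma blocks_subset: "R \<in> blocks M \<Longrightarrow> R \<subseteq> X"
  using partition_on partition_on_subset_Pow by (metis Pow_iff blocks_cases empty_subsetI subsetD)

text \<open>Any partition in \<open>M\<close> with block \<open>R\<close> refines this pair, since
  its other blocks are disjoint from \<open>R\<close>.\<close>

lemma pair_in:
  assumes "R \<in> blocks M" "R \<noteq> {}" "R \<noteq> X"
  shows "{R, X - R} \<in> M"
proof -
  obtain p where p: "p \<in> M" "R \<in> p"
    using assms(1,2) by (metis blocks_cases)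
  have RX: "R \<subseteq> X" using blocks_subset assms(1) by simp
  show ?thesis
  proof (rule coarsen[OF p(1)])
    show "partition_on X {R, X - R}"
      by (rule partition_onI) (use RX assms in \<open>auto simp: disjnt_def\<close>)
    show "\<exists>b\<in>{R, X - R}. a \<subseteq> b" if a: "a \<in> p" for a
    proof (cases "a = R")
      case False
      then have "a \<inter> R = {}"
        using partition_on_unique[OF partition_on[OF p(1)] a p(2)] by blast
      moreover have "a \<subseteq> X" using a p(1) blocks_subset blocksI by metis
      ultimately show ?thesis by blast
    qed simp
  qed
qed

lemma space_in_blocks: "X \<in> blocks M"
\<comment> \<open>For nonempty \<open>X\<close> the coarsest partition \<open>{X}\<close> belongs to
  \<open>M\<close>; for empty \<open>X\<close> it is not a partition, but then \<open>X\<close> is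
  the adjoined empty set.\<close>
proof (cases "X = {}")
  case False
  obtain p where p: "p \<in> M" using partition_exists by blast
  have "{X} \<in> M"
  proof (rule coarsen[OF p partition_on_space[OF False]])
    show "\<exists>b\<in>{X}. a \<subseteq> b" if "a \<in> p" for a
      using that p blocks_subset blocksI by (metis singletonI)
  qed
  then show ?thesis by (rule blocksI) simp
qed (simp add: blocks_def)

text \<open>Complements come from \<open>pair_in\<close>; a nonempty intersection of two blocks is a
  block of the common refinement.\<close>

lemma algebra_blocks: "algebra X (blocks M)"
  unfolding algebra_iff_Int
proof (intro conjI ballI)
  show "blocks M \<subseteq> Pow X" using blocks_subset by blast
  show "{} \<in> blocks M" by (rule empty_in_blocks)
  fix R assume R: "R \<in> blocks M"
  show "X - R \<in> blocks M"
  proof (cases "R = {} \<or> R = X")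
    case True
    then show ?thesis using space_in_blocks empty_in_blocks by auto
  next
    case False
    then have "{R, X - R} \<in> M" using pair_in R by simp
    then show ?thesis by (rule blocksI) simp
  qed
  fix S assume S: "S \<in> blocks M"
  show "R \<inter> S \<in> blocks M"
  proof (cases "R \<inter> S = {}")
    case False
    obtain p q where pq: "p \<in> M" "q \<in> M" "R \<in> p" "S \<in> q"
      using R S False by (metis blocks_cases Int_empty_left Int_empty_right)
    then have "R \<inter> S \<in> set_meet p q" using False unfolding set_meet_def by blast
    then show ?thesis by (rule blocksI[OF set_meet_in[OF pq(1,2)]])
  qed (simp add: empty_in_blocks)
qed

sublocale blocks: algebra X "blocks M"
  by (rule algebra_blocks)

lemma subset_blocks: "p \<in> M \<Longrightarrow> p \<subseteq> blocks M"
  using blocksI by blast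

text \<open>The filter property must be moved from \<open>Pow X\<close> to the smaller algebra.
  Upward closure is the delicate point: a partition of the subalgebra refined by a member of
  \<open>M\<close> covers \<open>X\<close>, hence is a partition of the set
  \<open>X\<close>.\<close>

lemma partition_filter_blocks: "partition_filter (set_algebra (blocks M)) M"
  unfolding partition_filter_def
proof (intro conjI ballI impI)
  show "M \<subseteq> partitions (set_algebra (blocks M))"
    using blocks.partition_on_imp_partitions partition_on subset_blocks by blast
  show "M \<noteq> {}" using partition_exists by blast
  fix p assume p: "p \<in> M"
  show "partition_meet (set_algebra (blocks M)) p q \<in> M" if "q \<in> M" for q
    using p that by (simp add: blocks.partition_meet_sets subset_blocks set_meet_in)
  fix q assume q: "q \<in> partitions (set_algebra (blocks M))"
    and ref: "Defs.refines (set_algebra (blocks M)) p q"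
  have qS: "q \<subseteq> blocks M" "{} \<notin> q"
    and disj: "\<And>a b. a \<in> q \<Longrightarrow> b \<in> q \<Longrightarrow> a \<noteq> b \<Longrightarrow> a \<sqinter>\<^bsub>set_algebra (blocks M)\<^esub> b = {}"
    using q unfolding partitions_def by (auto simp: blocks.bottom_sets)
  have "partition_on X q"
  proof (rule partition_on_refined[OF partition_on[OF p]])
    show "q \<subseteq> Pow X" using qS(1) blocks_subset by blast
    show "a \<inter> b = {}" if "a \<in> q" "b \<in> q" "a \<noteq> b" for a b
      using disj[OF that] blocks.meet_sets[of a b] qS(1) that by auto
  qed (use qS ref in simp_all)
  then show "q \<in> M" using coarsen[OF p] ref by simp
qed

lemma boolean_partition_alg_B_star: "boolean_partition_alg (B_star (X, M))"
  using pair_in blocks.cmpl_sets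
  by (simp add: B_star_eq blocks.boolean_alg_sets partition_filter_blocks
      blocks.bottom_sets blocks.top_sets)

text \<open>A point of \<open>R\<close> determines a thread by selecting, in each partition, the
  block that contains it.\<close>

lemma stable_alg_B_star: "stable_alg (B_star (X, M))"
  unfolding B_star_eq stable_alg.simps set_algebra_simps blocks.bottom_sets
proof
  fix R assume "R \<in> blocks M - {{}}"
  then obtain p z where p: "p \<in> M" "R \<in> p" and z: "z \<in> R"
    by (metis Diff_iff all_not_in_conv blocks_cases singletonI)
  have zX: "z \<in> X" using blocks_subset[OF blocksI[OF p]] z by blast
  \<comment> \<open>The restriction to \<open>M\<close> makes the thread extensional, as
    \<open>inverse_limit\<close> demands.\<close>
  define x where "x = (\<lambda>p\<in>M. THE a. a \<in> p \<and> z \<in> a)"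
  have x_eq: "x q = a" if "q \<in> M" "a \<in> q" "z \<in> a" for q a
    unfolding x_def using that partition_on_unique[OF partition_on[OF that(1)]]
    by (auto intro!: the_equality)
  have x_mem: "x q \<in> q \<and> z \<in> x q" if q: "q \<in> M" for q
  proof -
    obtain a where "a \<in> q" "z \<in> a" using zX partition_onD1[OF partition_on[OF q]] by blast
    then show ?thesis using x_eq[OF q] by simp
  qed
  have "x \<in> inverse_limit (set_algebra (blocks M), M)"
    unfolding inverse_limit.simps
  proof (intro CollectI conjI ballI impI)
    show "x \<in> (\<Pi>\<^sub>E p\<in>M. p)"
      using x_mem by (auto simp: x_def PiE_iff)
    fix p q assume pq: "p \<in> M" "q \<in> M" and ref: "Defs.refines (set_algebra (blocks M)) p q"
    obtain b where b: "b \<in> q" "x p \<subseteq> b" using ref x_mem[OF pq(1)] by auto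
    have "(THE b. b \<in> q \<and> x p \<subseteq> b) = x q"
    proof (rule the_equality)
      have "x q = b" using x_eq[OF pq(2) b(1)] x_mem[OF pq(1)] b(2) by blast
      then show "x q \<in> q \<and> x p \<subseteq> x q" using b by simp
      show "c = x q" if "c \<in> q \<and> x p \<subseteq> c" for c
        using x_eq[OF pq(2), of c] x_mem[OF pq(1)] that by blast
    qed
    then show "refine_map (set_algebra (blocks M)) p q (x p) = x q"
      using x_mem[OF pq(1)] by (simp add: refine_map_def)
  qed
  moreover have "x p = R" using x_eq p z by blast
  ultimately show "\<exists>x\<in>inverse_limit (set_algebra (blocks M), M). \<exists>p\<in>M. x p = R"
    using p(1) by blast
qed

sublocale B_star: stable_partition_algebra "set_algebra (blocks M)" M
  using boolean_partition_alg_B_star stable_alg_B_star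
  unfolding B_star_eq by (rule stable_partition_algebraI)

lemma F_ultrafilters_blocks_iff:
  "U \<in> F_ultrafilters (set_algebra (blocks M), M) \<longleftrightarrow>
     U \<subseteq> blocks M \<and> X \<in> U \<and> {} \<notin> U \<and> (\<forall>a\<in>U. \<forall>b\<in>U. a \<inter> b \<in> U) \<and>
     (\<forall>a\<in>U. \<forall>b\<in>blocks M. a \<subseteq> b \<longrightarrow> b \<in> U) \<and> (\<forall>p\<in>M. U \<inter> p \<noteq> {})"
  unfolding B_star.F_ultrafilters_iff blocks.proper_filter_sets by blast

lemma C_map_eq: "x \<in> X \<Longrightarrow> C_map (X, M) x = {R \<in> blocks M. x \<in> R}"
  by (simp add: C_map_def B_star_eq)

lemma C_map_in:
  assumes x: "x \<in> X"
  shows "C_map (X, M) x \<in> F_ultrafilters (B_star (X, M))"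
  unfolding B_star_eq F_ultrafilters_blocks_iff C_map_eq[OF x]
proof (intro conjI ballI impI)
  show "{R \<in> blocks M. x \<in> R} \<inter> p \<noteq> {}" if p: "p \<in> M" for p
  proof -
    obtain a where "a \<in> p" "x \<in> a" using x partition_onD1[OF partition_on[OF p]] by blast
    then show ?thesis using blocksI[OF p] by blast
  qed
qed (use x space_in_blocks in \<open>auto simp: blocks.Int\<close>)

text \<open>One of the two compositions in the third claim. It also yields uniform continuity of
  \<open>C_map\<close>.\<close>

lemma C_map_preimage_iota:
  assumes "R \<in> blocks M"
  shows "C_map (X, M) -` iota (B_star (X, M)) R \<inter> X = R"
proof -
  have "C_map (X, M) x \<in> iota (B_star (X, M)) R \<longleftrightarrow> x \<in> R" if "x \<in> X" for x
    using C_map_in[OF that] assms unfolding iota_def C_map_eq[OF that] by simp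
  then show ?thesis using blocks_subset[OF assms] by blast
qed

end


section \<open>The functors\<close>

text \<open>The uniform structure of the dual space, with the lattice notions already replaced by
  \<open>partition_on\<close> and inclusion.\<close>

definition S_partitions :: "'a gorder \<Rightarrow> 'a set set \<Rightarrow> 'a set set set set"
  where "S_partitions B F =
     {Z. partition_on (F_ultrafilters (B, F)) Z \<and> (\<exists>p\<in>F. \<forall>a\<in>p. \<exists>z\<in>Z. iota (B, F) a \<subseteq> z)}"

lemma S_star_eq: "S_star (B, F) = (F_ultrafilters (B, F), S_partitions B F)"
  by (simp add: S_star.simps partitions_Pow S_partitions_def)

lemma S_partitionsE:
  assumes "Z \<in> S_partitions B F"
  obtains p where "p \<in> F" "\<forall>a\<in>p. \<exists>z\<in>Z. iota (B, F) a \<subseteq> z"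
    "partition_on (F_ultrafilters (B, F)) Z"
  using assms unfolding S_partitions_def by blast

lemma psi_eq: "b \<in> carrier B \<Longrightarrow> psi (B, F) b = iota (B, F) b"
  by (simp add: psi_def)

lemma iota_iff: "U \<in> iota P a \<longleftrightarrow> U \<in> F_ultrafilters P \<and> a \<in> U"
  by (simp add: iota_def)

lemma iota_subset: "iota P a \<subseteq> F_ultrafilters P"
  by (simp add: iota_def)

section \<open>\<open>iota\<close> as a Boolean homomorphism\<close>

context partition_algebra
begin

lemma iota_bottom: "iota (B, F) \<bottom> = {}"
  using F_ultrafilter_bottom by (auto simp: iota_iff)

lemma iota_top: "iota (B, F) \<top> = F_ultrafilters (B, F)"
  using F_ultrafilter_top by (auto simp: iota_iff)

lemma iota_meet:
  "a \<in> carrier B \<Longrightarrow> b \<in> carrier B \<Longrightarrow> iota (B, F) (a \<sqinter> b) = iota (B, F) a \<inter> iota (B, F) b"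
  using F_ultrafilter_meet_iff by (auto simp: iota_iff)

lemma iota_join:
  "a \<in> carrier B \<Longrightarrow> b \<in> carrier B \<Longrightarrow> iota (B, F) (a \<squnion> b) = iota (B, F) a \<union> iota (B, F) b"
  using F_ultrafilter_join_iff by (auto simp: iota_iff)

text \<open>Maximality turns one inclusion into equality.\<close>

lemma F_ultrafilter_eqI:
  "U \<in> F_ultrafilters (B, F) \<Longrightarrow> V \<in> F_ultrafilters (B, F) \<Longrightarrow> U \<subseteq> V \<Longrightarrow> U = V"
  unfolding F_ultrafilters.simps ultrafilter_def by blast

end

context stable_partition_algebra
begin

lemma iota_image_in: "p \<in> F \<Longrightarrow> iota (B, F) ` p \<in> S_partitions B F"
  using partition_on_iota unfolding S_partitions_def by blast

lemma iota_in_blocks: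
  assumes "b \<in> carrier B"
  shows "iota (B, F) b \<in> blocks (S_partitions B F)"
proof (cases "b = \<bottom>")
  case True
  then show ?thesis by (simp add: iota_bottom empty_in_blocks)
next
  case False
  then obtain p where "p \<in> F" "b \<in> p" using in_some_partition assms by blast
  then show ?thesis using blocksI[OF iota_image_in] by blast
qed

text \<open>For closure under meets, if \<open>Z\<close> is coarser than the image of
  \<open>p\<close> and \<open>W\<close> than that of \<open>q\<close>, then their common refinement
  is coarser than the image of \<open>partition_meet B p q\<close>, because \<open>iota\<close>
  preserves meets.\<close>

lemma partition_sp_S_star: "partition_sp (F_ultrafilters (B, F)) (S_partitions B F)"
  unfolding partition_sp_def partition_space_iff
proof (intro conjI ballI impI allI)
  obtain p where "p \<in> F" using partition_filter unfolding partition_filter_def by blast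
  then show "S_partitions B F \<noteq> {}" using iota_image_in by blast
  fix Z assume Z: "Z \<in> S_partitions B F"
  then obtain p where p: "p \<in> F" "\<forall>a\<in>p. \<exists>z\<in>Z. iota (B, F) a \<subseteq> z"
    and partZ: "partition_on (F_ultrafilters (B, F)) Z"
    by (rule S_partitionsE)
  from partZ show "partition_on (F_ultrafilters (B, F)) Z" .
  show "W \<in> S_partitions B F"
    if "partition_on (F_ultrafilters (B, F)) W" "\<forall>z\<in>Z. \<exists>w\<in>W. z \<subseteq> w" for W
  proof -
    have "\<exists>w\<in>W. iota (B, F) a \<subseteq> w" if "a \<in> p" for a
      using p(2) that \<open>\<forall>z\<in>Z. \<exists>w\<in>W. z \<subseteq> w\<close> by (meson subset_trans)
    then show ?thesis using that(1) p(1) unfolding S_partitions_def by blast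
  qed
  fix W assume "W \<in> S_partitions B F"
  then obtain q where q: "q \<in> F" "\<forall>a\<in>q. \<exists>z\<in>W. iota (B, F) a \<subseteq> z"
    and partW: "partition_on (F_ultrafilters (B, F)) W"
    by (rule S_partitionsE)
  have m: "partition_meet B p q \<in> F"
    using partition_filter p(1) q(1) unfolding partition_filter_def by blast
  have "\<exists>z\<in>set_meet Z W. iota (B, F) c \<subseteq> z" if c: "c \<in> partition_meet B p q" for c
  proof -
    obtain a b where ab: "a \<in> p" "b \<in> q" "c = a \<sqinter> b" "c \<noteq> \<bottom>"
      using c unfolding partition_meet_def by blast
    have abB: "a \<in> carrier B" "b \<in> carrier B"
      using ab partition(1)[OF p(1)] partition(1)[OF q(1)] by auto
    obtain z w where zw: "z \<in> Z" "w \<in> W" "iota (B, F) a \<subseteq> z" "iota (B, F) b \<subseteq> w"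
      using p(2) q(2) ab by metis
    have sub: "iota (B, F) c \<subseteq> z \<inter> w" using zw iota_meet[OF abB] ab(3) by auto
    \<comment> \<open>Nonemptiness, from stability, ensures that \<open>z \<inter> w\<close> is not
      discarded by \<open>set_meet\<close>.\<close>
    have "iota (B, F) c \<noteq> {}" using iota_nonempty[of c] ab abB by simp
    then have "z \<inter> w \<in> set_meet Z W" using sub zw unfolding set_meet_def by blast
    then show ?thesis using sub by blast
  qed
  then show "set_meet Z W \<in> S_partitions B F"
    using m partition_on_set_meet[OF partZ partW] unfolding S_partitions_def by blast
qed

text \<open>The image of \<open>p\<close> is one of the generating partitions of the dual space. It
  has no empty member, so deleting bottom leaves it unchanged.\<close>

lemma partition_hom_psi: "partition_hom (B, F) (B_star (S_star (B, F))) (psi (B, F))"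
proof -
  interpret S: partition_sp "F_ultrafilters (B, F)" "S_partitions B F"
    by (rule partition_sp_S_star)
  have psi_image: "psi (B, F) ` p = iota (B, F) ` p" if "p \<in> F" for p
    by (rule image_cong) (use partition(1)[OF that] in \<open>auto simp: psi_eq\<close>)
  have "boolean_hom B (set_algebra (blocks (S_partitions B F))) (psi (B, F))"
    by (rule boolean_homI[OF boolean_alg_axioms S.blocks.boolean_alg_sets])
      (simp_all add: psi_eq iota_in_blocks S.blocks.bottom_sets S.blocks.top_sets
        S.blocks.meet_sets S.blocks.join_sets iota_bottom iota_top iota_meet iota_join)
  moreover have "psi (B, F) ` p - {{}} \<in> S_partitions B F" if "p \<in> F" for p
    using iota_image_in[OF that] partition_onD3[OF partition_on_iota[OF that]]
    by (simp add: psi_image[OF that])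
  ultimately show ?thesis
    by (simp add: S_star_eq B_star_eq S.blocks.bottom_sets)
qed

end

text \<open>Since \<open>f\<close> carries \<open>p\<close>, up to bottom, to a partition in
  \<open>G\<close>, the ultrafilter \<open>U\<close> selects some \<open>f a\<close> with
  \<open>a \<in> p\<close>. By \<open>F_ultrafilters_iff\<close> this already settles maximality and
  uniqueness of the selected member.\<close>

lemma preimage_F_ultrafilter:
  assumes "partition_algebra A F" "partition_algebra B G" "partition_hom (A, F) (B, G) f"
    and U: "U \<in> F_ultrafilters (B, G)"
  shows "f -` U \<inter> carrier A \<in> F_ultrafilters (A, F)"
proof -
  interpret A: partition_algebra A F by (rule assms(1))
  interpret B: partition_algebra B G by (rule assms(2))
  have hom: "boolean_hom A B f" and part: "\<And>p. p \<in> F \<Longrightarrow> f ` p - {\<bottom>\<^bsub>B\<^esub>} \<in> G"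
    using assms(3) by simp_all
  have fB: "f a \<in> carrier B" if "a \<in> carrier A" for a
    using hom that unfolding boolean_hom_def by blast
  have f_bot: "f \<bottom>\<^bsub>A\<^esub> = \<bottom>\<^bsub>B\<^esub>" and f_top: "f \<top>\<^bsub>A\<^esub> = \<top>\<^bsub>B\<^esub>"
    and f_meet: "\<And>a b. a \<in> carrier A \<Longrightarrow> b \<in> carrier A \<Longrightarrow> f (a \<sqinter>\<^bsub>A\<^esub> b) = f a \<sqinter>\<^bsub>B\<^esub> f b"
    using hom unfolding boolean_hom_def by simp_all
  show ?thesis
    unfolding A.F_ultrafilters_iff proper_filter_def
  proof (intro conjI ballI impI)
    show "\<top>\<^bsub>A\<^esub> \<in> f -` U \<inter> carrier A" using B.F_ultrafilter_top[OF U] by (simp add: f_top)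
    show "\<bottom>\<^bsub>A\<^esub> \<notin> f -` U \<inter> carrier A" using B.F_ultrafilter_bottom[OF U] by (simp add: f_bot)
    show "a \<sqinter>\<^bsub>A\<^esub> b \<in> f -` U \<inter> carrier A"
      if "a \<in> f -` U \<inter> carrier A" "b \<in> f -` U \<inter> carrier A" for a b
      using that B.F_ultrafilter_meet_iff[OF U, of "f a" "f b"] fB by (simp add: f_meet)
    show "b \<in> f -` U \<inter> carrier A"
      if a: "a \<in> f -` U \<inter> carrier A" and b: "b \<in> carrier A" and ab: "a \<sqsubseteq>\<^bsub>A\<^esub> b" for a b
    proof -
      \<comment> \<open>Monotonicity of \<open>f\<close> is recovered from preservation of
        meets.\<close>
      have "f a = f a \<sqinter>\<^bsub>B\<^esub> f b"
        using A.le_iff_join[of a b] a b ab f_meet[of a b] by auto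
      then show ?thesis using B.F_ultrafilter_meet_iff[OF U, of "f a" "f b"] a b fB by auto
    qed
    show "f -` U \<inter> carrier A \<inter> p \<noteq> {}" if p: "p \<in> F" for p
      using B.F_ultrafilter_block[OF U part[OF p]] A.partition(1)[OF p] by blast
  qed simp
qed

text \<open>If \<open>iota (A, F) a\<close> lies in a block \<open>z\<close>, then
  \<open>iota (B, G) (f a)\<close> lies in the preimage of \<open>z\<close>. So the image partition
  of \<open>p\<close> under \<open>f\<close> witnesses that the preimage of \<open>Z\<close> belongs
  to the structure.\<close>

lemma unif_continuous_S_star_map:
  assumes "stable_partition_algebra A F" "stable_partition_algebra B G"
    and hom: "partition_hom (A, F) (B, G) f"
  shows "unif_continuous (S_star (B, G)) (S_star (A, F)) (S_star_map (A, F) (B, G) f)"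
    (is "unif_continuous _ _ ?g")
proof -
  interpret A: stable_partition_algebra A F by (rule assms(1))
  interpret B: stable_partition_algebra B G by (rule assms(2))
  let ?FA = "F_ultrafilters (A, F)" and ?FB = "F_ultrafilters (B, G)"
  have g_eq: "?g U = f -` U \<inter> carrier A" if "U \<in> ?FB" for U
    using that by (simp add: S_star_map_def)
  have g: "?g \<in> ?FB \<rightarrow> ?FA"
    using preimage_F_ultrafilter[OF A.partition_algebra_axioms B.partition_algebra_axioms hom] g_eq
    by simp
  have "(\<lambda>R. ?g -` R \<inter> ?FB) ` Z - {{}} \<in> S_partitions B G" (is "?W \<in> _")
    if Z: "Z \<in> S_partitions A F" for Z
  proof -
    obtain p where p: "p \<in> F" "\<forall>a\<in>p. \<exists>z\<in>Z. iota (A, F) a \<subseteq> z"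
      and partZ: "partition_on ?FA Z"
      using Z by (rule S_partitionsE)
    have q: "f ` p - {\<bottom>\<^bsub>B\<^esub>} \<in> G" using hom p(1) by simp
    have "\<exists>w\<in>?W. iota (B, G) b \<subseteq> w" if b: "b \<in> f ` p - {\<bottom>\<^bsub>B\<^esub>}" for b
    proof -
      obtain a where a: "a \<in> p" "b = f a" using b by blast
      obtain z where z: "z \<in> Z" "iota (A, F) a \<subseteq> z" using p(2)[rule_format, OF a(1)] by blast
      have aA: "a \<in> carrier A" using A.partition(1)[OF p(1)] a(1) by blast
      have "?g U \<in> z" if "U \<in> iota (B, G) b" for U
      proof -
        have U: "U \<in> ?FB" "f a \<in> U" using that a(2) by (simp_all add: iota_iff)
        have "?g U \<in> ?FA" using g U(1) by blast
        moreover have "a \<in> ?g U" using g_eq[OF U(1)] U(2) aA by simp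
        ultimately have "?g U \<in> iota (A, F) a" by (simp add: iota_iff)
        then show ?thesis using z(2) by blast
      qed
      then have sub: "iota (B, G) b \<subseteq> ?g -` z \<inter> ?FB" using iota_subset by fast
      have "b \<in> carrier B" "b \<noteq> \<bottom>\<^bsub>B\<^esub>" using B.partition(1)[OF q] b by auto
      \<comment> \<open>Only nonempty preimages survive in \<open>?W\<close>; this one contains
        \<open>iota (B, G) b\<close> with \<open>b\<close> nonzero.\<close>
      then have "?g -` z \<inter> ?FB \<noteq> {}" using B.iota_nonempty[of b] sub by fast
      then show ?thesis using sub z(1) by blast
    qed
    then show ?thesis
      using q partition_on_preimage[OF partZ g] unfolding S_partitions_def by blast
  qed
  then show ?thesis using g by (simp add: S_star_eq)
qed

lemma B_star_map_eq: "R \<in> blocks N \<Longrightarrow> B_star_map (X, M) (Y, N) f R = f -` R \<inter> X"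
  by (simp add: B_star_map_def B_star_eq)

text \<open>Uniform continuity covers the nonempty preimages only; an empty one is a block by
  convention.\<close>

lemma preimage_in_blocks:
  assumes "unif_continuous (X, M) (Y, N) f" "R \<in> blocks N"
  shows "f -` R \<inter> X \<in> blocks M"
  using assms(2)
proof (rule blocks_cases)
  fix Q assume Q: "Q \<in> N" "R \<in> Q"
  then have "(\<lambda>R. f -` R \<inter> X) ` Q - {{}} \<in> M" using assms(1) by simp
  then show ?thesis
    using blocksI[of _ M "f -` R \<inter> X"] Q(2)
    by (cases "f -` R \<inter> X = {}") (auto simp: empty_in_blocks)
qed (simp add: empty_in_blocks)

lemma partition_hom_B_star_map:
  assumes "partition_sp X M" "partition_sp Y N" and f: "unif_continuous (X, M) (Y, N) f"
  shows "partition_hom (B_star (Y, N)) (B_star (X, M)) (B_star_map (X, M) (Y, N) f)"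
proof -
  interpret X: partition_sp X M by (rule assms(1))
  interpret Y: partition_sp Y N by (rule assms(2))
  let ?h = "B_star_map (X, M) (Y, N) f"
  have fXY: "f -` Y \<inter> X = X" using f by auto
  have "boolean_hom (set_algebra (blocks N)) (set_algebra (blocks M)) ?h"
  proof (rule boolean_homI[OF Y.blocks.boolean_alg_sets X.blocks.boolean_alg_sets])
    show "?h \<top>\<^bsub>set_algebra (blocks N)\<^esub> = \<top>\<^bsub>set_algebra (blocks M)\<^esub>"
      using fXY by (simp add: X.blocks.top_sets Y.blocks.top_sets B_star_map_eq Y.space_in_blocks)
  next
    fix R S
    assume "R \<in> carrier (set_algebra (blocks N))" "S \<in> carrier (set_algebra (blocks N))"
    then have RS: "R \<in> blocks N" "S \<in> blocks N" by simp_all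
    note preimages = preimage_in_blocks[OF f RS(1)] preimage_in_blocks[OF f RS(2)]
    show "?h (R \<sqinter>\<^bsub>set_algebra (blocks N)\<^esub> S) = ?h R \<sqinter>\<^bsub>set_algebra (blocks M)\<^esub> ?h S"
      unfolding Y.blocks.meet_sets[OF RS] B_star_map_eq[OF RS(1)] B_star_map_eq[OF RS(2)]
        B_star_map_eq[OF Y.blocks.Int[OF RS]] X.blocks.meet_sets[OF preimages] by blast
    show "?h (R \<squnion>\<^bsub>set_algebra (blocks N)\<^esub> S) = ?h R \<squnion>\<^bsub>set_algebra (blocks M)\<^esub> ?h S"
      unfolding Y.blocks.join_sets[OF RS] B_star_map_eq[OF RS(1)] B_star_map_eq[OF RS(2)]
        B_star_map_eq[OF Y.blocks.Un[OF RS]] X.blocks.join_sets[OF preimages] by blast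
  qed (simp_all add: B_star_map_eq preimage_in_blocks[OF f] empty_in_blocks
      X.blocks.bottom_sets Y.blocks.bottom_sets)
  moreover have "?h ` Q - {{}} \<in> M" if Q: "Q \<in> N" for Q
  proof -
    have "?h ` Q = (\<lambda>R. f -` R \<inter> X) ` Q"
      by (rule image_cong) (simp_all add: B_star_map_eq blocksI[OF Q])
    then show ?thesis using f Q by simp
  qed
  ultimately show ?thesis by (simp add: B_star_eq X.blocks.bottom_sets)
qed

section \<open>The double dual of a partition space\<close>

context partition_sp
begin

text \<open>The preimage of \<open>iota (B_star (X, M)) a\<close> is \<open>a\<close> itself, so the
  very \<open>p\<close> that witnesses membership of \<open>Z\<close> refines the preimage of
  \<open>Z\<close>.\<close>

lemma unif_continuous_C_map: "unif_continuous (X, M) (S_star (B_star (X, M))) (C_map (X, M))"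
proof -
  let ?FU = "F_ultrafilters (set_algebra (blocks M), M)"
  have C: "C_map (X, M) \<in> X \<rightarrow> ?FU"
    using C_map_in by (simp add: B_star_eq)
  have "(\<lambda>R. C_map (X, M) -` R \<inter> X) ` Z - {{}} \<in> M" (is "?W \<in> M")
    if Z: "Z \<in> S_partitions (set_algebra (blocks M)) M" for Z
  proof -
    obtain p where p: "p \<in> M" "\<forall>a\<in>p. \<exists>z\<in>Z. iota (B_star (X, M)) a \<subseteq> z"
      and partZ: "partition_on ?FU Z"
      using Z unfolding B_star_eq by (rule S_partitionsE)
    show ?thesis
    proof (rule coarsen[OF p(1) partition_on_preimage[OF partZ C]])
      fix a assume a: "a \<in> p"
      obtain z where z: "z \<in> Z" "iota (B_star (X, M)) a \<subseteq> z" using p(2)[rule_format, OF a] by blast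
      have "a \<subseteq> C_map (X, M) -` z \<inter> X"
        using C_map_preimage_iota[OF blocksI[OF p(1) a]] z(2) by blast
      moreover have "a \<noteq> {}" using partition_onD3[OF partition_on[OF p(1)]] a by blast
      ultimately show "\<exists>b\<in>?W. a \<subseteq> b" using z(1) by blast
    qed
  qed
  then show ?thesis using C by (simp add: B_star_eq S_star_eq)
qed

text \<open>The other composition in the third claim. An ultrafilter \<open>U\<close> selects some
  \<open>a \<in> p\<close>, and the block \<open>z'\<close> above the image of \<open>a\<close> is
  the block of \<open>Z\<close> containing \<open>U\<close>; comparing \<open>z'\<close> with
  \<open>z\<close> decides both memberships.\<close>

lemma iota_C_map_preimage:
  assumes "z \<in> blocks (S_partitions (set_algebra (blocks M)) M)"
  shows "iota (B_star (X, M)) (C_map (X, M) -` z \<inter> X) = z"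
  using assms
proof (rule blocks_cases)
  assume "z = {}"
  then show ?thesis using B_star.iota_bottom unfolding B_star_eq blocks.bottom_sets by simp
next
  let ?C = "C_map (X, M)" and ?FU = "F_ultrafilters (set_algebra (blocks M), M)"
  fix Z assume Z: "Z \<in> S_partitions (set_algebra (blocks M)) M" "z \<in> Z"
  from Z(1) obtain p where p: "p \<in> M" "\<forall>a\<in>p. \<exists>z\<in>Z. iota (B_star (X, M)) a \<subseteq> z"
    and partZ: "partition_on ?FU Z"
    unfolding B_star_eq by (rule S_partitionsE)
  \<comment> \<open>Uniform continuity of \<open>C_map\<close> places this preimage in the algebra
    of blocks, as upward closure of \<open>U\<close> requires.\<close>
  have R: "?C -` z \<inter> X \<in> blocks M" (is "?R \<in> _")
    using preimage_in_blocks[OF _ assms] unif_continuous_C_map by (simp add: B_star_eq S_star_eq)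
  have "?R \<in> U \<longleftrightarrow> U \<in> z" if U: "U \<in> ?FU" for U
  proof -
    obtain a where a: "a \<in> p" "a \<in> U" using B_star.F_ultrafilter_block[OF U p(1)] by blast
    obtain z' where z': "z' \<in> Z" "iota (B_star (X, M)) a \<subseteq> z'" using p(2)[rule_format, OF a(1)] by blast
    have a_sub: "a \<subseteq> ?C -` z' \<inter> X"
      using C_map_preimage_iota[OF blocksI[OF p(1) a(1)]] z'(2) by blast
    have Uz': "U \<in> z'" using z'(2) U a(2) by (auto simp: iota_iff B_star_eq)
    show ?thesis
    proof (cases "z' = z")
      case True
      then show ?thesis using B_star.F_ultrafilter_up[OF U a(2), of ?R] a_sub R Uz' by simp
    next
      case False
      then have disj: "z' \<inter> z = {}" using partition_on_unique[OF partZ z'(1) Z(2)] by blast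
      then have "a \<inter> ?R = {}" using a_sub by blast
      \<comment> \<open>Otherwise the intersection of \<open>a\<close> and \<open>?R\<close>, which
        is empty, would belong to \<open>U\<close>.\<close>
      then have "?R \<notin> U" using U a(2) unfolding F_ultrafilters_blocks_iff by metis
      then show ?thesis using disj Uz' by blast
    qed
  qed
  moreover have "z \<subseteq> ?FU" using partition_onD1[OF partZ] Z(2) by blast
  ultimately show ?thesis unfolding B_star_eq by (auto simp: iota_iff)
qed

end

section \<open>The double dual of a stable partition algebra\<close>

context stable_partition_algebra
begin

text \<open>Unfolding both natural maps, \<open>b\<close> is in the left side exactly when
  \<open>U\<close> lies in \<open>iota (B, F) b\<close>, that is, when
  \<open>b \<in> U\<close>.\<close>

lemma S_star_map_psi_C_map:
  assumes U: "U \<in> F_ultrafilters (B, F)"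
  shows "psi (B, F) -` C_map (S_star (B, F)) U \<inter> carrier B = U"
proof -
  interpret S: partition_sp "F_ultrafilters (B, F)" "S_partitions B F"
    by (rule partition_sp_S_star)
  have "psi (B, F) b \<in> C_map (S_star (B, F)) U \<longleftrightarrow> b \<in> U" if "b \<in> carrier B" for b
    unfolding S_star_eq S.C_map_eq[OF U] psi_eq[OF that]
    using iota_in_blocks[OF that] U by (simp add: iota_iff)
  then show ?thesis using F_ultrafilter_subset[OF U] by blast
qed

text \<open>By maximality it suffices that every block \<open>R\<close> containing the pulled-back
  ultrafilter \<open>?U\<close> belongs to \<open>V\<close>. If \<open>R\<close> is in a partition
  \<open>Z\<close> coarser than the image of \<open>p\<close>, then \<open>R\<close> contains
  \<open>iota (B, F) a\<close> for the \<open>a \<in> p\<close> selected by \<open>?U\<close>, and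
  \<open>V\<close> is upward closed.\<close>

lemma C_map_S_star_map_psi:
  assumes V: "V \<in> F_ultrafilters (B_star (S_star (B, F)))"
  shows "C_map (S_star (B, F)) (psi (B, F) -` V \<inter> carrier B) = V"
proof -
  interpret S: partition_sp "F_ultrafilters (B, F)" "S_partitions B F"
    by (rule partition_sp_S_star)
  note V' = V[unfolded S_star_eq B_star_eq]
  let ?U = "psi (B, F) -` V \<inter> carrier B"
  have U: "?U \<in> F_ultrafilters (B, F)"
    using preimage_F_ultrafilter[OF partition_algebra_axioms S.B_star.partition_algebra_axioms _ V']
      partition_hom_psi unfolding S_star_eq B_star_eq by blast
  have "C_map (F_ultrafilters (B, F), S_partitions B F) ?U = V"
  proof (rule S.B_star.F_ultrafilter_eqI[OF _ V'])
    show "C_map (F_ultrafilters (B, F), S_partitions B F) ?U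
        \<in> F_ultrafilters (set_algebra (blocks (S_partitions B F)), S_partitions B F)"
      using S.C_map_in[OF U] unfolding B_star_eq .
    show "C_map (F_ultrafilters (B, F), S_partitions B F) ?U \<subseteq> V"
    proof
      fix R assume "R \<in> C_map (F_ultrafilters (B, F), S_partitions B F) ?U"
      then have R: "R \<in> blocks (S_partitions B F)" "?U \<in> R" using S.C_map_eq[OF U] by auto
      then obtain Z where Z: "Z \<in> S_partitions B F" "R \<in> Z" by (metis blocks_cases empty_iff)
      from Z(1) obtain p where p: "p \<in> F" "\<forall>a\<in>p. \<exists>z\<in>Z. iota (B, F) a \<subseteq> z"
        and partZ: "partition_on (F_ultrafilters (B, F)) Z"
        by (rule S_partitionsE)
      obtain a where a: "a \<in> p" "a \<in> ?U" using F_ultrafilter_block[OF U p(1)] by blast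
      obtain z where z: "z \<in> Z" "iota (B, F) a \<subseteq> z" using p(2)[rule_format, OF a(1)] by blast
      have "?U \<in> iota (B, F) a" using U a(2) by (simp add: iota_iff)
      then have "?U \<in> z" using z(2) by blast
      then have "z = R" using partition_on_unique[OF partZ z(1) Z(2)] R(2) by blast
      moreover have "iota (B, F) a \<in> V" using a(2) psi_eq[of a B F] by simp
      ultimately show "R \<in> V"
        using S.B_star.F_ultrafilter_up[OF V', of "iota (B, F) a" R] R(1) z(2) by simp
    qed
  qed
  then show ?thesis unfolding S_star_eq .
qed

end

section \<open>Naturality and the inverse pairs\<close>

lemma S_star_map_C_map:
  assumes "partition_sp X M" "partition_sp Y N" and f: "unif_continuous (X, M) (Y, N) f"
    and x: "x \<in> X"
  shows "S_star_map (B_star (Y, N)) (B_star (X, M)) (B_star_map (X, M) (Y, N) f) (C_map (X, M) x)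
    = C_map (Y, N) (f x)"
proof -
  interpret X: partition_sp X M by (rule assms(1))
  interpret Y: partition_sp Y N by (rule assms(2))
  let ?h = "B_star_map (X, M) (Y, N) f"
  have fx: "f x \<in> Y" using f x by auto
  \<comment> \<open>Both conditions say that \<open>x\<close> lies in the preimage of
    \<open>R\<close> under \<open>f\<close>.\<close>
  have "?h R \<in> C_map (X, M) x \<longleftrightarrow> f x \<in> R" if "R \<in> blocks N" for R
    unfolding X.C_map_eq[OF x] B_star_map_eq[OF that]
    using preimage_in_blocks[OF f that] x by simp
  then have "?h -` C_map (X, M) x \<inter> blocks N = C_map (Y, N) (f x)"
    unfolding Y.C_map_eq[OF fx] by blast
  then show ?thesis
    using X.C_map_in[OF x] by (simp add: S_star_map_def B_star_eq)
qed

lemma B_star_map_psi: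
  assumes "stable_partition_algebra A F" "stable_partition_algebra B G"
    and hom: "partition_hom (A, F) (B, G) f" and a: "a \<in> carrier A"
  shows "B_star_map (S_star (B, G)) (S_star (A, F)) (S_star_map (A, F) (B, G) f) (psi (A, F) a)
    = psi (B, G) (f a)"
proof -
  interpret A: stable_partition_algebra A F by (rule assms(1))
  interpret B: stable_partition_algebra B G by (rule assms(2))
  let ?g = "S_star_map (A, F) (B, G) f"
  have fa: "f a \<in> carrier B"
    using hom a by (auto simp: boolean_hom_def)
  \<comment> \<open>Pulling \<open>U\<close> back along \<open>f\<close> turns membership of
    \<open>a\<close> into membership of \<open>f a\<close> in \<open>U\<close>.\<close>
  have "?g U \<in> iota (A, F) a \<longleftrightarrow> f a \<in> U" if U: "U \<in> F_ultrafilters (B, G)" for U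
    using preimage_F_ultrafilter[OF A.partition_algebra_axioms B.partition_algebra_axioms hom U] U a
    by (simp add: S_star_map_def iota_iff)
  then have "?g -` iota (A, F) a \<inter> F_ultrafilters (B, G) = iota (B, G) (f a)"
    unfolding iota_def[of "(B, G)"] by blast
  then show ?thesis
    by (simp add: S_star_eq psi_eq a fa B_star_map_eq[OF A.iota_in_blocks[OF a]])
qed

lemma B_star_C_map_psi_inverse:
  assumes "partition_sp X M"
  shows "mutually_inverse
    (carrier (fst (B_star (S_star (B_star (X, M)))))) (carrier (fst (B_star (X, M))))
    (B_star_map (X, M) (S_star (B_star (X, M))) (C_map (X, M))) (psi (B_star (X, M)))"
proof -
  interpret partition_sp X M by (rule assms)
  let ?SP = "S_partitions (set_algebra (blocks M)) M"
  let ?h = "B_star_map (X, M) (S_star (B_star (X, M))) (C_map (X, M))"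
  have h: "?h z = C_map (X, M) -` z \<inter> X" "?h z \<in> blocks M" if "z \<in> blocks ?SP" for z
    using preimage_in_blocks[OF unif_continuous_C_map[unfolded B_star_eq S_star_eq] that]
    by (simp_all add: B_star_eq S_star_eq B_star_map_eq[OF that])
  have psi: "psi (B_star (X, M)) R = iota (B_star (X, M)) R"
    "psi (B_star (X, M)) R \<in> blocks ?SP" if "R \<in> blocks M" for R
    using B_star.iota_in_blocks[of R] that by (simp_all add: B_star_eq psi_eq)
  have carrier: "carrier (fst (B_star (S_star (B_star (X, M))))) = blocks ?SP"
    "carrier (fst (B_star (X, M))) = blocks M"
    by (simp_all add: B_star_eq S_star_eq)
  show ?thesis
    unfolding mutually_inverse_def carrier
  proof (intro conjI ballI)
    show "psi (B_star (X, M)) (?h z) = z" if "z \<in> blocks ?SP" for z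
      using psi(1)[OF h(2)[OF that]] h(1)[OF that] iota_C_map_preimage[OF that] by simp
    show "?h (psi (B_star (X, M)) R) = R" if "R \<in> blocks M" for R
      using h(1)[OF psi(2)[OF that]] psi(1)[OF that] C_map_preimage_iota[OF that] by simp
  qed (use h psi in auto)
qed

lemma S_star_psi_C_map_inverse:
  assumes "stable_partition_algebra B F"
  shows "mutually_inverse
    (fst (S_star (B_star (S_star (B, F))))) (fst (S_star (B, F)))
    (S_star_map (B, F) (B_star (S_star (B, F))) (psi (B, F))) (C_map (S_star (B, F)))"
proof -
  interpret stable_partition_algebra B F by (rule assms)
  interpret S: partition_sp "F_ultrafilters (B, F)" "S_partitions B F"
    by (rule partition_sp_S_star)
  let ?FU = "F_ultrafilters (B, F)" and ?FV = "F_ultrafilters (B_star (S_star (B, F)))"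
  let ?g = "S_star_map (B, F) (B_star (S_star (B, F))) (psi (B, F))"
  have g: "?g V = psi (B, F) -` V \<inter> carrier B" if "V \<in> ?FV" for V
    using that by (simp add: S_star_map_def)
  have g_in: "?g V \<in> ?FU" if "V \<in> ?FV" for V
    unfolding g[OF that]
    using preimage_F_ultrafilter[OF partition_algebra_axioms S.B_star.partition_algebra_axioms]
      partition_hom_psi that unfolding S_star_eq B_star_eq by blast
  have C_in: "C_map (S_star (B, F)) U \<in> ?FV" if "U \<in> ?FU" for U
    using S.C_map_in[OF that] by (simp add: S_star_eq)
  have fst: "fst (S_star (B_star (S_star (B, F)))) = ?FV" "fst (S_star (B, F)) = ?FU"
    by (simp_all add: S_star_eq B_star_eq)
  show ?thesis
    unfolding mutually_inverse_def fst
  proof (intro conjI ballI)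
    show "C_map (S_star (B, F)) (?g V) = V" if "V \<in> ?FV" for V
      using C_map_S_star_map_psi[OF that] g[OF that] by simp
    show "?g (C_map (S_star (B, F)) U) = U" if "U \<in> ?FU" for U
      using S_star_map_psi_C_map[OF that] g[OF C_in[OF that]] by simp
  qed (use g_in C_in in auto)
qed

text \<open>The last two conjuncts also assert that the maps are morphisms, so the inverse pairs are
  isomorphisms of partition algebras and of partition spaces.\<close>

theorem theorem2p6:
  shows
    "(\<forall>(X :: 'x set) M (Y :: 'y set) N f.
        partition_space (X, M) \<and> partition_space (Y, N) \<and> unif_continuous (X, M) (Y, N) f \<longrightarrow>
        compose X
          (S_star_map (B_star (Y, N)) (B_star (X, M)) (B_star_map (X, M) (Y, N) f))
          (C_map (X, M))
        = compose X (C_map (Y, N)) f)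
     \<and>
     (\<forall>(A :: 'a gorder) F (B :: 'b gorder) G f.
        boolean_partition_alg (A, F) \<and> stable_alg (A, F) \<and>
        boolean_partition_alg (B, G) \<and> stable_alg (B, G) \<and> partition_hom (A, F) (B, G) f \<longrightarrow>
        compose (carrier A)
          (B_star_map (S_star (B, G)) (S_star (A, F)) (S_star_map (A, F) (B, G) f))
          (psi (A, F))
        = compose (carrier A) (psi (B, G)) f)
     \<and>
     (\<forall>(X :: 'x set) M.
        partition_space (X, M) \<longrightarrow>
        partition_hom (B_star (S_star (B_star (X, M)))) (B_star (X, M))
          (B_star_map (X, M) (S_star (B_star (X, M))) (C_map (X, M))) \<and>
        partition_hom (B_star (X, M)) (B_star (S_star (B_star (X, M))))
          (psi (B_star (X, M))) \<and>
        mutually_inverse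
          (carrier (fst (B_star (S_star (B_star (X, M)))))) (carrier (fst (B_star (X, M))))
          (B_star_map (X, M) (S_star (B_star (X, M))) (C_map (X, M)))
          (psi (B_star (X, M))))
     \<and>
     (\<forall>(B :: 'b gorder) F.
        boolean_partition_alg (B, F) \<and> stable_alg (B, F) \<longrightarrow>
        unif_continuous (S_star (B_star (S_star (B, F)))) (S_star (B, F))
          (S_star_map (B, F) (B_star (S_star (B, F))) (psi (B, F))) \<and>
        unif_continuous (S_star (B, F)) (S_star (B_star (S_star (B, F))))
          (C_map (S_star (B, F))) \<and>
        mutually_inverse
          (fst (S_star (B_star (S_star (B, F))))) (fst (S_star (B, F)))
          (S_star_map (B, F) (B_star (S_star (B, F))) (psi (B, F)))
          (C_map (S_star (B, F))))"
proof (intro conjI allI impI; (elim conjE)?)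
  fix X :: "'x set" and M and Y :: "'y set" and N f
  assume "partition_space (X, M)" "partition_space (Y, N)" "unif_continuous (X, M) (Y, N) f"
  then show "compose X (S_star_map (B_star (Y, N)) (B_star (X, M)) (B_star_map (X, M) (Y, N) f))
      (C_map (X, M)) = compose X (C_map (Y, N)) f"
    unfolding compose_def by (intro restrict_ext S_star_map_C_map partition_sp.intro)
next
  fix A :: "'a gorder" and F and B :: "'b gorder" and G f
  assume "boolean_partition_alg (A, F)" "stable_alg (A, F)"
    "boolean_partition_alg (B, G)" "stable_alg (B, G)" "partition_hom (A, F) (B, G) f"
  then show "compose (carrier A)
      (B_star_map (S_star (B, G)) (S_star (A, F)) (S_star_map (A, F) (B, G) f)) (psi (A, F))
      = compose (carrier A) (psi (B, G)) f"
    unfolding compose_def by (intro restrict_ext B_star_map_psi stable_partition_algebraI)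
next
  fix X :: "'x set" and M
  assume "partition_space (X, M)"
  then interpret X: partition_sp X M by (rule partition_sp.intro)
  show "partition_hom (B_star (S_star (B_star (X, M)))) (B_star (X, M))
      (B_star_map (X, M) (S_star (B_star (X, M))) (C_map (X, M)))"
    \<comment> \<open>The contravariant functor is applied to \<open>C_map\<close>, whose target is
      the dual space of the algebra of blocks.\<close>
    using partition_hom_B_star_map[OF X.partition_sp_axioms X.B_star.partition_sp_S_star]
      X.unif_continuous_C_map by (simp only: B_star_eq S_star_eq)
  show "partition_hom (B_star (X, M)) (B_star (S_star (B_star (X, M)))) (psi (B_star (X, M)))"
    using X.B_star.partition_hom_psi by (simp only: B_star_eq)
  show "mutually_inverse
      (carrier (fst (B_star (S_star (B_star (X, M)))))) (carrier (fst (B_star (X, M))))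
      (B_star_map (X, M) (S_star (B_star (X, M))) (C_map (X, M))) (psi (B_star (X, M)))"
    by (rule B_star_C_map_psi_inverse) (rule X.partition_sp_axioms)
next
  fix B :: "'b gorder" and F
  assume "boolean_partition_alg (B, F)" "stable_alg (B, F)"
  then interpret B: stable_partition_algebra B F by (rule stable_partition_algebraI)
  interpret S: partition_sp "F_ultrafilters (B, F)" "S_partitions B F"
    by (rule B.partition_sp_S_star)
  show "unif_continuous (S_star (B_star (S_star (B, F)))) (S_star (B, F))
      (S_star_map (B, F) (B_star (S_star (B, F))) (psi (B, F)))"
    \<comment> \<open>The algebra of blocks of the dual space is again stable, so \<open>psi\<close>
      is a morphism between stable algebras.\<close>
    using unif_continuous_S_star_map[OF B.stable_partition_algebra_axioms
        S.B_star.stable_partition_algebra_axioms] B.partition_hom_psi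
    by (simp only: B_star_eq S_star_eq)
  show "unif_continuous (S_star (B, F)) (S_star (B_star (S_star (B, F)))) (C_map (S_star (B, F)))"
    using S.unif_continuous_C_map by (simp only: S_star_eq)
  show "mutually_inverse
      (fst (S_star (B_star (S_star (B, F))))) (fst (S_star (B, F)))
      (S_star_map (B, F) (B_star (S_star (B, F))) (psi (B, F))) (C_map (S_star (B, F)))"
    by (rule S_star_psi_C_map_inverse) (rule B.stable_partition_algebra_axioms)
qed

end
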